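(* Let $M=(m_{s,t})_{s,t\in S}$ be a Coxeter matrix over a finite set $S$ and $A_S$ its associated Artin group. Then $A_S$ is parabolic-retractable if and only if $M$ is parabolic-retract-compatible.
   Context: A Coxeter matrix over a finite set $S$ is a matrix $M=(m_{s,t})_{s,t\in S}$ with entries in $\mathbb{N}\cup\{\infty\}$, $m_{s,s}=1$, and $m_{s,t}=m_{t,s}\ge 2$ for $s\neq t$. Write $\Pi(s,t,m)$ for the alternating word $sts\cdots$ of length $m$. The Artin group of $M$ is $A_S=\langle S\mid \Pi(s,t,m_{s,t})=\Pi(t,s,m_{s,t})$ for $s\neq t$, $m_{s,t}\neq\infty\rangle$. For $X\subseteq S$, $A_X$ is the subgroup generated by $X$, and $M_X$ the submatrix of $M$ indexed by $X$. A retraction of $G$ onto a subgroup $H$ is a homomorphism $\varphi:G\to H$ with $\varphi|_H=\mathrm{id}_H$. $A_S$ is parabolic-retractable if it admits a retraction onto $A_X$ for every $X\subseteq S$. $M$ is odd if all its entries are finite odd numbers. $M$ is retract-compatible if it is odd and for every triple $a,b,c\in S$ of pairwise distinct elements, up to permuting $a,b,c$, one has $m_{a,b}=m_{a,c}$ and $m_{b,c}$ divides $m_{a,b}$; a Coxeter matrix of rank $1$ is always considered retract-compatible. $M$ is parabolic-retract-compatible if there is a partition $S=T_1\sqcup\cdots\sqcup T_k$ such that (1) each $M_{T_i}$ is retract-compatible, and (2) for each $i\neq j$ there exists $n_{ij}$, either an even number or $\infty$, with $m_{a,b}=n_{ij}$ for all $(a,b)\in T_i\times T_j$. *)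

theory Defs
  imports "HOL-Algebra.Generated_Groups" "HOL-Library.Extended_Nat" "HOL-Library.Disjoint_Sets"
begin

definition coxeter_matrix :: "'a set \<Rightarrow> ('a \<Rightarrow> 'a \<Rightarrow> enat) \<Rightarrow> bool" where
  "coxeter_matrix S M \<longleftrightarrow>
     (\<forall>s\<in>S. M s s = 1) \<and>
     (\<forall>s\<in>S. \<forall>t\<in>S. s \<noteq> t \<longrightarrow> M s t = M t s \<and> M s t \<ge> 2)"

text \<open>Words in the free group on S: letters (s, True) = s, (s, False) = s inverse.\<close>
type_synonym 'a word = "('a \<times> bool) list"

definition words :: "'a set \<Rightarrow> 'a word set" where
  "words S = {w. \<forall>x\<in>set w. fst x \<in> S}"

fun alt :: "'a \<Rightarrow> 'a \<Rightarrow> nat \<Rightarrow> 'a word" where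
  "alt s t 0 = []"
| "alt s t (Suc m) = (s, True) # alt t s m"

inductive artin_eq :: "'a set \<Rightarrow> ('a \<Rightarrow> 'a \<Rightarrow> enat) \<Rightarrow> 'a word \<Rightarrow> 'a word \<Rightarrow> bool"
  for S M where
  refl: "w \<in> words S \<Longrightarrow> artin_eq S M w w"
| sym: "artin_eq S M u v \<Longrightarrow> artin_eq S M v u"
| trans: "artin_eq S M u v \<Longrightarrow> artin_eq S M v w \<Longrightarrow> artin_eq S M u w"
| cancel: "u \<in> words S \<Longrightarrow> v \<in> words S \<Longrightarrow> s \<in> S \<Longrightarrow>
     artin_eq S M (u @ [(s, b), (s, \<not> b)] @ v) (u @ v)"
| braid: "u \<in> words S \<Longrightarrow> v \<in> words S \<Longrightarrow> s \<in> S \<Longrightarrow> t \<in> S \<Longrightarrow> s \<noteq> t \<Longrightarrow>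
     M s t = enat m \<Longrightarrow> artin_eq S M (u @ alt s t m @ v) (u @ alt t s m @ v)"

definition artin_rel :: "'a set \<Rightarrow> ('a \<Rightarrow> 'a \<Rightarrow> enat) \<Rightarrow> ('a word \<times> 'a word) set" where
  "artin_rel S M = {(u, v). artin_eq S M u v}"

definition artin_group :: "'a set \<Rightarrow> ('a \<Rightarrow> 'a \<Rightarrow> enat) \<Rightarrow> 'a word set monoid" where
  "artin_group S M =
     \<lparr> carrier = words S // artin_rel S M,
       mult = (\<lambda>A B. artin_rel S M `` {(SOME u. u \<in> A) @ (SOME v. v \<in> B)}),
       one = artin_rel S M `` {[]} \<rparr>"

definition artin_gen :: "'a set \<Rightarrow> ('a \<Rightarrow> 'a \<Rightarrow> enat) \<Rightarrow> 'a \<Rightarrow> 'a word set" where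
  "artin_gen S M s = artin_rel S M `` {[(s, True)]}"

definition parabolic_subgroup :: "'a set \<Rightarrow> ('a \<Rightarrow> 'a \<Rightarrow> enat) \<Rightarrow> 'a set \<Rightarrow> 'a word set set" where
  "parabolic_subgroup S M X = generate (artin_group S M) (artin_gen S M ` X)"

definition has_retraction :: "('g, 'b) monoid_scheme \<Rightarrow> 'g set \<Rightarrow> bool" where
  "has_retraction G H \<longleftrightarrow>
     (\<exists>\<phi>. \<phi> \<in> hom G (G\<lparr>carrier := H\<rparr>) \<and> (\<forall>x\<in>H. \<phi> x = x))"

definition parabolic_retractable :: "'a set \<Rightarrow> ('a \<Rightarrow> 'a \<Rightarrow> enat) \<Rightarrow> bool" where
  "parabolic_retractable S M \<longleftrightarrow>
     (\<forall>X. X \<subseteq> S \<longrightarrow> has_retraction (artin_group S M) (parabolic_subgroup S M X))"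

definition odd_matrix :: "'a set \<Rightarrow> ('a \<Rightarrow> 'a \<Rightarrow> enat) \<Rightarrow> bool" where
  "odd_matrix S M \<longleftrightarrow> (\<forall>s\<in>S. \<forall>t\<in>S. \<exists>m. M s t = enat m \<and> odd m)"

definition retract_compatible :: "'a set \<Rightarrow> ('a \<Rightarrow> 'a \<Rightarrow> enat) \<Rightarrow> bool" where
  "retract_compatible S M \<longleftrightarrow> card S = 1 \<or>
     (odd_matrix S M \<and>
      (\<forall>a\<in>S. \<forall>b\<in>S. \<forall>c\<in>S. a \<noteq> b \<and> a \<noteq> c \<and> b \<noteq> c \<longrightarrow>
         (\<exists>x y z. {x, y, z} = {a, b, c} \<and> M x y = M x z \<and>
            (\<exists>p q. M x y = enat p \<and> M y z = enat q \<and> q dvd p))))"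

definition parabolic_retract_compatible :: "'a set \<Rightarrow> ('a \<Rightarrow> 'a \<Rightarrow> enat) \<Rightarrow> bool" where
  "parabolic_retract_compatible S M \<longleftrightarrow>
     (\<exists>P. partition_on S P \<and>
        (\<forall>T\<in>P. retract_compatible T M) \<and>
        (\<forall>T\<in>P. \<forall>T'\<in>P. T \<noteq> T' \<longrightarrow>
           (\<exists>n. (n = \<infinity> \<or> (\<exists>k. n = enat k \<and> even k)) \<and>
                (\<forall>a\<in>T. \<forall>b\<in>T'. M a b = n))))"

end

theory Submission
  imports Defs Complex_Main
begin

text \<open>
  If M is parabolic-retract-compatible, then inside each block the entries form an ultrametric with
  respect to divisibility, so sending every generator outside X to a suitable nearest generator of X
  in its block (or to 1 if there is none) respects the braid relations.

  Conversely, the Artin group acts on the real functions on S by symplectic transvections \<open>T\<^sub>s\<close>,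
  where the alternating form takes the values \<open>\<plusminus>2 cos (\<pi> / m\<^sub>s\<^sub>t)\<close>, or \<open>\<plusminus>2\<close> when \<open>m\<^sub>s\<^sub>t\<close> is
  infinite. A retraction onto \<open>A\<^bsub>{a,c}\<^esub>\<close> sends a generator b with \<open>m\<^sub>a\<^sub>b\<close> odd to a conjugate of a
  inside \<open>A\<^bsub>{a,c}\<^esub>\<close>, which acts on the plane of a and c as the transvection along a vector w in the
  orbit of (1, 0) under a Hecke triangle group. Two transvections satisfy the braid relation of length k
  only if a Chebyshev polynomial vanishes at their symplectic product, whereas a coordinate
  of w is 0, is \<open>\<plusminus>1\<close>, or makes that product at least 2 in absolute value. Hence \<open>m\<^sub>a\<^sub>c\<close> divides
  \<open>m\<^sub>a\<^sub>b\<close> or \<open>m\<^sub>b\<^sub>c\<close> if it is odd, divides \<open>m\<^sub>b\<^sub>c\<close> if it is even, and is infinite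
  only if \<open>m\<^sub>b\<^sub>c\<close> is.
\<close>

subsection \<open>Words, Artin groups and retractions\<close>

lemma words_Nil [simp]: "[] \<in> words S"
  by (simp add: words_def)

lemma words_Cons [simp]: "x # w \<in> words S \<longleftrightarrow> fst x \<in> S \<and> w \<in> words S"
  by (auto simp: words_def)

lemma words_append [simp]: "u @ v \<in> words S \<longleftrightarrow> u \<in> words S \<and> v \<in> words S"
  by (auto simp: words_def)

lemma words_mono: "X \<subseteq> S \<Longrightarrow> words X \<subseteq> words S"
  by (auto simp: words_def)

lemma words_alt: "s \<in> S \<Longrightarrow> t \<in> S \<Longrightarrow> alt s t k \<in> words S"
  by (induction k arbitrary: s t) auto

lemma alt_Suc_right: "alt s t (Suc k) = alt s t k @ [(if even k then s else t, True)]"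
proof (induction k arbitrary: s t)
  case (Suc k)
  have "alt s t (Suc (Suc k)) = (s, True) # alt t s (Suc k)" by simp
  also have "\<dots> = (s, True) # alt t s k @ [(if even k then t else s, True)]"
    by (simp only: Suc.IH)
  finally show ?case by simp
qed simp

lemma artin_eq_words: "artin_eq S M u v \<Longrightarrow> u \<in> words S \<and> v \<in> words S"
  by (induction rule: artin_eq.induct) (auto simp: words_alt)

lemma artin_eq_context:
  assumes "artin_eq S M u v" "x \<in> words S" "y \<in> words S"
  shows "artin_eq S M (x @ u @ y) (x @ v @ y)"
  using assms
proof (induction rule: artin_eq.induct)
  case (refl w)
  then show ?case by (simp add: artin_eq.refl)
next
  case (sym u v)
  then show ?case by (blast intro: artin_eq.sym)
next
  case (trans u v w)
  then show ?case by (blast intro: artin_eq.trans)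
next
  case (cancel u v s b)
  then show ?case using artin_eq.cancel[of "x @ u" S "v @ y" s M b] by simp
next
  case (braid u v s t m)
  then show ?case using artin_eq.braid[of "x @ u" S "v @ y" s t M m] by simp
qed

lemma artin_eq_append:
  assumes "artin_eq S M u u'" "artin_eq S M v v'"
  shows "artin_eq S M (u @ v) (u' @ v')"
  using artin_eq_context[OF assms(1), of "[]" v] artin_eq_context[OF assms(2), of u' "[]"]
    artin_eq_words[OF assms(1)] artin_eq_words[OF assms(2)]
  by (auto intro: artin_eq.trans)

lemma artin_eq_left_inverse:
  "w \<in> words S \<Longrightarrow> \<exists>v\<in>words S. artin_eq S M (v @ w) []"
proof (induction w)
  case Nil
  then show ?case by (intro bexI[of _ "[]"]) (auto intro: artin_eq.refl)
next
  case (Cons x w)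
  obtain s b where x: "x = (s, b)" by (cases x)
  obtain v where v: "v \<in> words S" "artin_eq S M (v @ w) []"
    using Cons by auto
  have "artin_eq S M (v @ [(s, \<not> b), (s, \<not> \<not> b)] @ w) (v @ w)"
    using v Cons.prems x by (intro artin_eq.cancel) auto
  then show ?case
    using v Cons.prems x by (intro bexI[of _ "v @ [(s, \<not> b)]"]) (auto intro: artin_eq.trans)
qed

section \<open>The group of word classes and its parabolic subgroups\<close>

definition artin_class :: "'a set \<Rightarrow> ('a \<Rightarrow> 'a \<Rightarrow> enat) \<Rightarrow> 'a word \<Rightarrow> 'a word set" where
  "artin_class S M w = artin_rel S M `` {w}"

lemma mem_artin_class: "v \<in> artin_class S M u \<longleftrightarrow> artin_eq S M u v"
  by (simp add: artin_class_def artin_rel_def)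

lemma artin_class_eq_iff:
  assumes "u \<in> words S"
  shows "artin_class S M u = artin_class S M v \<longleftrightarrow> artin_eq S M u v"
  using artin_eq.refl[OF assms, of M]
  by (auto simp: set_eq_iff mem_artin_class intro: artin_eq.sym artin_eq.trans)

lemma artin_class_repr:
  assumes "w \<in> words S"
  shows "artin_eq S M w (SOME u. u \<in> artin_class S M w)"
  using someI[of "\<lambda>u. u \<in> artin_class S M w" w] artin_eq.refl[OF assms, of M]
  by (simp add: mem_artin_class)

lemma carrier_artin_group: "carrier (artin_group S M) = artin_class S M ` words S"
  by (auto simp: artin_group_def quotient_def artin_class_def)

lemma one_artin_group: "\<one>\<^bsub>artin_group S M\<^esub> = artin_class S M []"
  by (simp add: artin_group_def artin_class_def)

lemma artin_gen_eq_class: "artin_gen S M s = artin_class S M [(s, True)]"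
  by (simp add: artin_gen_def artin_class_def)

text \<open>The product of \<open>artin_group\<close> goes through chosen representatives; since
  \<open>artin_eq\<close> is a congruence for concatenation, the choice does not affect the
  class.\<close>

lemma mult_artin_class:
  assumes "u \<in> words S" "v \<in> words S"
  shows "artin_class S M u \<otimes>\<^bsub>artin_group S M\<^esub> artin_class S M v = artin_class S M (u @ v)"
proof -
  have "artin_class S M (u @ v) = artin_class S M
      ((SOME x. x \<in> artin_class S M u) @ (SOME x. x \<in> artin_class S M v))"
    using assms by (simp add: artin_class_eq_iff artin_eq_append artin_class_repr)
  then show ?thesis
    by (simp add: artin_group_def artin_class_def)
qed

lemma group_artin_group: "group (artin_group S M)"
proof (rule groupI)
  fix x assume "x \<in> carrier (artin_group S M)"
  then obtain u where u: "u \<in> words S" "x = artin_class S M u"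
    by (auto simp: carrier_artin_group)
  obtain v where "v \<in> words S" "artin_eq S M (v @ u) []"
    using artin_eq_left_inverse[OF u(1)] by blast
  then show "\<exists>y\<in>carrier (artin_group S M). y \<otimes>\<^bsub>artin_group S M\<^esub> x = \<one>\<^bsub>artin_group S M\<^esub>"
    using u by (auto simp: carrier_artin_group mult_artin_class one_artin_group artin_class_eq_iff)
qed (auto simp: carrier_artin_group mult_artin_class one_artin_group)

lemma inv_artin_gen:
  assumes "s \<in> S"
  shows "inv\<^bsub>artin_group S M\<^esub> (artin_gen S M s) = artin_class S M [(s, False)]"
proof -
  have "artin_eq S M ([] @ [(s, False), (s, \<not> False)] @ []) ([] @ [])"
    using assms by (intro artin_eq.cancel) auto
  then show ?thesis
    using assms
    by (intro group.inv_equality[OF group_artin_group])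
       (auto simp: carrier_artin_group artin_gen_eq_class mult_artin_class one_artin_group
         artin_class_eq_iff)
qed

text \<open>Classes are taken with respect to all of \<open>S\<close>, so this describes A_X inside
  A_S and not the abstract Artin group of the submatrix.\<close>

lemma parabolic_subgroup_eq:
  assumes "X \<subseteq> S"
  shows "parabolic_subgroup S M X = artin_class S M ` words X"
proof (intro equalityI subsetI)
  fix x assume "x \<in> parabolic_subgroup S M X"
  then have "x \<in> generate (artin_group S M) (artin_gen S M ` X)"
    by (simp add: parabolic_subgroup_def)
  then show "x \<in> artin_class S M ` words X"
  proof induction
    case one
    then show ?case by (simp add: one_artin_group)
  next
    case (incl h)
    then show ?case by (auto simp: artin_gen_eq_class)
  next
    case (inv h)
    then obtain s where "s \<in> X" "h = artin_gen S M s" by blast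
    then show ?case using assms by (auto simp: inv_artin_gen)
  next
    case (eng h g)
    then obtain u v where "u \<in> words X" "v \<in> words X" "h = artin_class S M u" "g = artin_class S M v"
      by blast
    then show ?case
      using words_mono[OF assms] by (auto simp: mult_artin_class subset_iff)
  qed
next
  fix x assume "x \<in> artin_class S M ` words X"
  then obtain w where "w \<in> words X" "x = artin_class S M w" by blast
  then show "x \<in> parabolic_subgroup S M X"
  proof (induction w arbitrary: x)
    case Nil
    then show ?case
      using generate.one[of "artin_group S M"] by (simp add: parabolic_subgroup_def one_artin_group)
  next
    case (Cons l w)
    obtain s b where l: "l = (s, b)" by (cases l)
    then have s: "s \<in> X" "s \<in> S" "w \<in> words S" using Cons.prems assms words_mono[OF assms] by auto
    have "artin_class S M [l] \<in> parabolic_subgroup S M X"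
      using s l generate.incl[of "artin_gen S M s" "artin_gen S M ` X" "artin_group S M"]
        generate.inv[of "artin_gen S M s" "artin_gen S M ` X" "artin_group S M"]
      by (cases b) (auto simp: parabolic_subgroup_def artin_gen_eq_class[symmetric] inv_artin_gen[symmetric])
    moreover have "artin_class S M w \<in> parabolic_subgroup S M X" using Cons by auto
    moreover have "artin_class S M [l] \<otimes>\<^bsub>artin_group S M\<^esub> artin_class S M w = x"
      using s l Cons.prems by (simp add: mult_artin_class)
    ultimately show ?case
      unfolding parabolic_subgroup_def by (metis generate.eng)
  qed
qed

text \<open>A retraction read on representatives. All laws hold only up to
  \<open>artin_eq S M\<close>, so that arbitrarily chosen image words qualify as well as explicit
  substitutions of letters.\<close>

definition word_retraction ::
  "'a set \<Rightarrow> ('a \<Rightarrow> 'a \<Rightarrow> enat) \<Rightarrow> 'a set \<Rightarrow> ('a word \<Rightarrow> 'a word) \<Rightarrow> bool" where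
  "word_retraction S M X f \<longleftrightarrow>
     (\<forall>u\<in>words S. f u \<in> words X) \<and>
     (\<forall>u\<in>words S. \<forall>v\<in>words S. artin_eq S M (f (u @ v)) (f u @ f v)) \<and>
     (\<forall>u v. artin_eq S M u v \<longrightarrow> artin_eq S M (f u) (f v)) \<and>
     (\<forall>u\<in>words X. artin_eq S M (f u) u)"

lemma has_retraction_iff_word_retraction:
  assumes "X \<subseteq> S"
  shows "has_retraction (artin_group S M) (parabolic_subgroup S M X)
           \<longleftrightarrow> (\<exists>f. word_retraction S M X f)"
proof
  have sub: "words X \<subseteq> words S" by (rule words_mono[OF assms])
  assume "has_retraction (artin_group S M) (parabolic_subgroup S M X)"
  then obtain \<phi> where hom: "\<phi> \<in> hom (artin_group S M)
        (artin_group S M\<lparr>carrier := parabolic_subgroup S M X\<rparr>)"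
    and id: "\<forall>x\<in>parabolic_subgroup S M X. \<phi> x = x"
    unfolding has_retraction_def by blast
  define f where "f u = (SOME x. x \<in> words X \<and> \<phi> (artin_class S M u) = artin_class S M x)" for u
  have f: "f u \<in> words X" "\<phi> (artin_class S M u) = artin_class S M (f u)" if "u \<in> words S" for u
  proof -
    have "\<phi> (artin_class S M u) \<in> artin_class S M ` words X"
      using that hom assms
      by (auto simp: hom_def carrier_artin_group parabolic_subgroup_eq Pi_iff)
    then have "\<exists>x. x \<in> words X \<and> \<phi> (artin_class S M u) = artin_class S M x" by blast
    from someI_ex[OF this] show "f u \<in> words X" "\<phi> (artin_class S M u) = artin_class S M (f u)"
      by (auto simp: f_def)
  qed
  have fS: "f u \<in> words S" if "u \<in> words S" for u using f(1)[OF that] sub by blast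
  have "artin_eq S M (f (u @ v)) (f u @ f v)" if "u \<in> words S" "v \<in> words S" for u v
  proof -
    have "artin_class S M (f (u @ v)) = \<phi> (artin_class S M u \<otimes>\<^bsub>artin_group S M\<^esub> artin_class S M v)"
      using that f(2)[of "u @ v"] by (simp add: mult_artin_class)
    also have "\<dots> = \<phi> (artin_class S M u) \<otimes>\<^bsub>artin_group S M\<^esub> \<phi> (artin_class S M v)"
      using hom that by (auto simp: hom_def carrier_artin_group)
    also have "\<dots> = artin_class S M (f u @ f v)"
      using that fS by (simp add: f(2) mult_artin_class)
    finally show ?thesis using that fS by (simp add: artin_class_eq_iff)
  qed
  moreover have "artin_eq S M (f u) (f v)" if "artin_eq S M u v" for u v
    using f(2) fS artin_eq_words[OF that] that by (metis artin_class_eq_iff)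
  moreover have "artin_eq S M (f u) u" if "u \<in> words X" for u
    using f(2) fS id that sub assms
    by (metis artin_class_eq_iff imageI parabolic_subgroup_eq subsetD)
  ultimately show "\<exists>f. word_retraction S M X f"
    using f(1) unfolding word_retraction_def by blast
next
  have sub: "words X \<subseteq> words S" by (rule words_mono[OF assms])
  assume "\<exists>f. word_retraction S M X f"
  then obtain f where f: "\<And>u. u \<in> words S \<Longrightarrow> f u \<in> words X"
    "\<And>u v. u \<in> words S \<Longrightarrow> v \<in> words S \<Longrightarrow> artin_eq S M (f (u @ v)) (f u @ f v)"
    "\<And>u v. artin_eq S M u v \<Longrightarrow> artin_eq S M (f u) (f v)"
    "\<And>u. u \<in> words X \<Longrightarrow> artin_eq S M (f u) u"
    unfolding word_retraction_def by blast
  have fS: "f u \<in> words S" if "u \<in> words S" for u using f(1)[OF that] sub by blast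
  define \<phi> where "\<phi> A = artin_class S M (f (SOME u. u \<in> A))" for A
  have \<phi>: "\<phi> (artin_class S M u) = artin_class S M (f u)" if "u \<in> words S" for u
    unfolding \<phi>_def using fS[OF that] f(3)[OF artin_class_repr[OF that]]
    by (metis artin_class_eq_iff)
  have "\<phi> \<in> hom (artin_group S M) (artin_group S M\<lparr>carrier := parabolic_subgroup S M X\<rparr>)"
    using assms fS f(1,2)
    by (auto simp: hom_def carrier_artin_group parabolic_subgroup_eq \<phi> mult_artin_class
        artin_class_eq_iff)
  moreover have "\<phi> x = x" if x: "x \<in> parabolic_subgroup S M X" for x
  proof -
    obtain u where "u \<in> words X" "x = artin_class S M u"
      using x by (auto simp: parabolic_subgroup_eq[OF assms])
    then show ?thesis
      using f(4)[of u] sub fS[of u] by (auto simp: \<phi> subset_iff artin_class_eq_iff)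
  qed
  ultimately show "has_retraction (artin_group S M) (parabolic_subgroup S M X)"
    unfolding has_retraction_def by blast
qed

subsection \<open>Compatible matrices have retractions\<close>

lemma alt_add: "alt s t (k + n) = alt s t k @ (if even k then alt s t n else alt t s n)"
  by (induction k arbitrary: s t) auto

text \<open>The alternating word is cut into j blocks of length k, each swapped by the braid
  relation. This is why a divisor of \<open>M s t\<close> may serve as the entry between the images
  of s and t.\<close>

lemma artin_eq_alt_mult:
  assumes "s \<in> S" "t \<in> S" "s \<noteq> t" "M s t = enat k"
  shows "artin_eq S M (alt s t (k * j)) (alt t s (k * j))"
proof (induction j)
  case 0
  then show ?case by (simp add: artin_eq.refl)
next
  case (Suc j)
  have "artin_eq S M (alt s t k) (alt t s k)"
    using artin_eq.braid[of "[]" S "[]" s t M k] assms by simp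
  then show ?case
    using Suc artin_eq.sym[OF Suc] by (auto simp: alt_add intro: artin_eq_append)
qed

text \<open>The free group homomorphism determined by g on generators, where \<open>None\<close>
  stands for the identity element.\<close>

definition rename_letters :: "('a \<Rightarrow> 'a option) \<Rightarrow> 'a word \<Rightarrow> 'a word" where
  "rename_letters g w = concat (map (\<lambda>(s, b). case g s of None \<Rightarrow> [] | Some t \<Rightarrow> [(t, b)]) w)"

lemma rename_letters_simps [simp]:
  "rename_letters g [] = []"
  "rename_letters g ((s, b) # w) =
     (case g s of None \<Rightarrow> [] | Some t \<Rightarrow> [(t, b)]) @ rename_letters g w"
  "rename_letters g (u @ v) = rename_letters g u @ rename_letters g v"
  by (simp_all add: rename_letters_def)

lemma rename_letters_alt_Some:
  assumes "g s = Some x" "g t = Some y"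
  shows "rename_letters g (alt s t m) = alt x y m"
  using assms by (induction m arbitrary: s t x y) auto

lemma rename_letters_alt_None:
  assumes "g s = None" "g t = None"
  shows "rename_letters g (alt s t m) = []"
  using assms by (induction m arbitrary: s t) auto

text \<open>With one generator killed, the two sides of a braid relation become powers of the other
  generator. The exponents agree exactly when m is even.\<close>

lemma rename_letters_alt_None_Some:
  assumes "g s = None" "g t = Some x"
  shows "rename_letters g (alt s t m) = replicate (m div 2) (x, True) \<and>
    rename_letters g (alt t s m) = replicate (Suc m div 2) (x, True)"
  using assms by (induction m) auto

lemma rename_letters_words:
  assumes "\<And>s t. s \<in> S \<Longrightarrow> g s = Some t \<Longrightarrow> t \<in> X" "w \<in> words S"
  shows "rename_letters g w \<in> words X"
  using assms(2)
proof (induction w)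
  case (Cons l w)
  then show ?case using assms(1) by (cases l) (auto split: option.split)
qed simp

text \<open>Free cancellation survives every substitution of letters, so only the braid relations
  remain as an assumption.\<close>

lemma word_retraction_rename_letters:
  assumes X: "X \<subseteq> S"
    and into: "\<And>s t. s \<in> S \<Longrightarrow> g s = Some t \<Longrightarrow> t \<in> X"
    and idX: "\<And>s. s \<in> X \<Longrightarrow> g s = Some s"
    and braid: "\<And>s t m. s \<in> S \<Longrightarrow> t \<in> S \<Longrightarrow> s \<noteq> t \<Longrightarrow> M s t = enat m \<Longrightarrow>
      artin_eq S M (rename_letters g (alt s t m)) (rename_letters g (alt t s m))"
  shows "word_retraction S M X (rename_letters g)"
proof -
  have inX: "rename_letters g u \<in> words X" if "u \<in> words S" for u
    using rename_letters_words into that by metis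
  then have inS: "rename_letters g u \<in> words S" if "u \<in> words S" for u
    using that words_mono[OF X] by blast
  have "artin_eq S M (rename_letters g u) (rename_letters g v)" if "artin_eq S M u v" for u v
    using that
  proof induction
    case (refl w)
    then show ?case by (simp add: artin_eq.refl inS)
  next
    case (sym u v)
    then show ?case by (blast intro: artin_eq.sym)
  next
    case (trans u v w)
    then show ?case by (blast intro: artin_eq.trans)
  next
    case (cancel u v s b)
    show ?case
    proof (cases "g s")
      case None
      then show ?thesis using cancel by (simp add: artin_eq.refl inS)
    next
      case (Some t)
      then have "t \<in> S" using into cancel X by blast
      then show ?thesis
        using Some cancel artin_eq.cancel[of "rename_letters g u" S "rename_letters g v" t M b]
        by (simp add: inS)
    qed
  next
    case (braid u v s t m)
    then show ?case
      using assms(4)[of s t m] by (simp add: artin_eq_context inS)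
  qed
  moreover have "rename_letters g u = u" if "u \<in> words X" for u
    using that
  proof (induction u)
    case (Cons l u)
    then show ?case using idX by (cases l) auto
  qed simp
  ultimately show ?thesis
    using inX words_mono[OF X] unfolding word_retraction_def
    by (auto simp: inS artin_eq.refl subset_iff)
qed

text \<open>Points outside Y are added one at a time, each sent where its nearest neighbour goes.\<close>

lemma divisibility_ultrametric_retraction:
  fixes m :: "'a \<Rightarrow> 'a \<Rightarrow> nat"
  assumes "finite Y" "Y \<noteq> {}" "finite F" "Y \<inter> F = {}"
    and "\<And>s t. s \<in> Y \<union> F \<Longrightarrow> t \<in> Y \<union> F \<Longrightarrow> m s t = m t s \<and> m s t > 0"
    and "\<And>a b c. a \<in> Y \<union> F \<Longrightarrow> b \<in> Y \<union> F \<Longrightarrow> c \<in> Y \<union> F \<Longrightarrow> a \<noteq> b \<Longrightarrow> a \<noteq> c \<Longrightarrow> b \<noteq> c \<Longrightarrow>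
      (m a b = m a c \<and> m b c dvd m a b) \<or> (m a b = m b c \<and> m a c dvd m a b) \<or>
      (m a c = m b c \<and> m a b dvd m a c)"
  shows "\<exists>r. (\<forall>s\<in>Y \<union> F. r s \<in> Y) \<and> (\<forall>s\<in>Y. r s = s) \<and>
    (\<forall>s\<in>Y \<union> F. \<forall>t\<in>Y \<union> F. r s \<noteq> r t \<longrightarrow> m (r s) (r t) dvd m s t)"
  using assms(3-)
proof (induction F rule: finite_induct)
  case empty
  then show ?case by (intro exI[of _ id]) auto
next
  case (insert s F)
  have "\<exists>r. (\<forall>s\<in>Y \<union> F. r s \<in> Y) \<and> (\<forall>s\<in>Y. r s = s) \<and>
      (\<forall>s\<in>Y \<union> F. \<forall>t\<in>Y \<union> F. r s \<noteq> r t \<longrightarrow> m (r s) (r t) dvd m s t)"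
    using insert.prems by (intro insert.IH) auto
  then obtain r where r: "\<forall>t\<in>Y \<union> F. r t \<in> Y" "\<forall>t\<in>Y. r t = t"
    "\<forall>u\<in>Y \<union> F. \<forall>t\<in>Y \<union> F. r u \<noteq> r t \<longrightarrow> m (r u) (r t) dvd m u t"
    by blast
  have fin: "finite (m s ` (Y \<union> F))" using assms(1) insert.hyps(1) by simp
  then have "Min (m s ` (Y \<union> F)) \<in> m s ` (Y \<union> F)" using assms(2) by (intro Min_in) auto
  then obtain t where t: "t \<in> Y \<union> F" "m s t = Min (m s ` (Y \<union> F))" by force
  have t_le: "m s t \<le> m s u" if "u \<in> Y \<union> F" for u
    unfolding t(2) using fin that by (intro Min_le) auto
  have s: "s \<notin> Y \<union> F" using insert by auto
  \<comment> \<open>In the one critical alternative, \<open>m s t = m t u\<close> and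
    \<open>m s u dvd m s t\<close>, the minimality of \<open>m s t\<close> makes all three distances
    equal.\<close>
  have near: "m t u dvd m s u" if "u \<in> Y \<union> F" "u \<noteq> t" for u
  proof -
    have "(m s t = m s u \<and> m t u dvd m s t) \<or> (m s t = m t u \<and> m s u dvd m s t) \<or>
        (m s u = m t u \<and> m s t dvd m s u)"
      using that t(1) s by (intro insert.prems(3)) auto
    moreover have "0 < m s t" "m s t \<le> m s u"
      using insert.prems(2)[of s t] t(1) t_le[OF that(1)] by auto
    ultimately show ?thesis by (metis dvd_refl dvd_imp_le le_antisym)
  qed
  have key: "m (r t) (r u) dvd m s u" if "u \<in> Y \<union> F" "r t \<noteq> r u" for u
    using r(3) t(1) near[of u] that by (metis dvd_trans)
  have "m (r u) (r t) dvd m u s" if "u \<in> Y \<union> F" "r t \<noteq> r u" for u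
    using key[OF that] insert.prems(2)[of "r t" "r u"] insert.prems(2)[of s u] r(1) that t(1) by auto
  then show ?case
    using r t(1) s key by (intro exI[of _ "r(s := r t)"]) auto
qed

section \<open>Retractions of a block and of the whole group\<close>

lemma retract_compatible_retraction:
  assumes "finite T" "coxeter_matrix T M" "retract_compatible T M" "Y \<subseteq> T" "Y \<noteq> {}"
  shows "\<exists>r. (\<forall>s\<in>T. r s \<in> Y) \<and> (\<forall>s\<in>Y. r s = s) \<and>
    (\<forall>s\<in>T. \<forall>t\<in>T. r s \<noteq> r t \<longrightarrow> (\<exists>p q. M s t = enat p \<and> M (r s) (r t) = enat q \<and> q dvd p))"
proof (cases "card T = 1")
  case True
  then obtain s where "T = {s}" by (auto simp: card_1_singleton_iff)
  then have "Y = {s}" using assms(4,5) by blast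
  then show ?thesis
    by (intro exI[of _ "\<lambda>_. s"] conjI ballI impI) simp_all
next
  case False
  define m where "m s t = the_enat (M s t)" for s t
  note rc = mp[OF assms(3)[unfolded retract_compatible_def disj_imp] False]
  have odd: "M s t = enat (m s t)" "odd (m s t)" if "s \<in> T" "t \<in> T" for s t
  proof -
    have "\<exists>k. M s t = enat k \<and> odd k"
      using conjunct1[OF rc] that unfolding odd_matrix_def by blast
    then show "M s t = enat (m s t)" "odd (m s t)" by (auto simp: m_def)
  qed
  have sym: "m s t = m t s" if "s \<in> T" "t \<in> T" for s t
    using assms(2) that unfolding coxeter_matrix_def m_def by metis
  have T: "T = Y \<union> (T - Y)" using assms by blast
  have "\<exists>r. (\<forall>s\<in>Y \<union> (T - Y). r s \<in> Y) \<and> (\<forall>s\<in>Y. r s = s) \<and>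
    (\<forall>s\<in>Y \<union> (T - Y). \<forall>t\<in>Y \<union> (T - Y). r s \<noteq> r t \<longrightarrow> m (r s) (r t) dvd m s t)"
  proof (rule divisibility_ultrametric_retraction)
    show "finite Y" "finite (T - Y)" using assms(1,4) by (auto intro: finite_subset)
    show "m s t = m t s \<and> m s t > 0" if "s \<in> Y \<union> (T - Y)" "t \<in> Y \<union> (T - Y)" for s t
      using sym[of s t] odd_pos[OF odd(2)[of s t]] that[folded T] by simp
    fix a b c assume abc: "a \<in> Y \<union> (T - Y)" "b \<in> Y \<union> (T - Y)" "c \<in> Y \<union> (T - Y)"
      "a \<noteq> b" "a \<noteq> c" "b \<noteq> c"
    then have T: "a \<in> T" "b \<in> T" "c \<in> T" using assms(4) by auto
    obtain x y z p q where xyz: "{x, y, z} = {a, b, c}" "M x y = M x z"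
      "M x y = enat p" "M y z = enat q" "q dvd p"
      using conjunct2[OF rc, rule_format, OF T conjI[OF abc(4) conjI[OF abc(5,6)]]]
      by blast
    have "x \<in> {a, b, c}" "y \<in> {a, b, c}" "z \<in> {a, b, c}"
      unfolding xyz(1)[symmetric] by simp_all
    moreover have "a \<in> {x, y, z}" "b \<in> {x, y, z}" "c \<in> {x, y, z}"
      unfolding xyz(1) by simp_all
    \<comment> \<open>Compatibility supplies only an equality of sets; for distinct a, b, c it means
      that x, y, z is one of the six permutations.\<close>
    ultimately have perm: "(x = a \<and> y = b \<and> z = c) \<or> (x = a \<and> y = c \<and> z = b) \<or>
        (x = b \<and> y = a \<and> z = c) \<or> (x = b \<and> y = c \<and> z = a) \<or>
        (x = c \<and> y = a \<and> z = b) \<or> (x = c \<and> y = b \<and> z = a)"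
      using abc(4-) by (simp only: insert_iff empty_iff) metis
    then have "x \<in> T" "y \<in> T" "z \<in> T" using T by auto
    then have m: "m x y = m x z" "m y z dvd m x y"
      using xyz(2-) odd(1)[of x y] odd(1)[of x z] odd(1)[of y z] by simp_all
    then show "(m a b = m a c \<and> m b c dvd m a b) \<or> (m a b = m b c \<and> m a c dvd m a b) \<or>
      (m a c = m b c \<and> m a b dvd m a c)"
      using perm sym[OF T(1,2)] sym[OF T(1,3)] sym[OF T(2,3)]
      by (elim disjE conjE; hypsubst; metis)
  qed (use assms(5) in simp_all)
  then obtain r where r: "\<forall>s\<in>T. r s \<in> Y" "\<forall>s\<in>Y. r s = s"
    "\<forall>s\<in>T. \<forall>t\<in>T. r s \<noteq> r t \<longrightarrow> m (r s) (r t) dvd m s t"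
    unfolding T[symmetric] by blast
  have in_T: "r s \<in> T" if "s \<in> T" for s using r(1) assms(4) that by blast
  have "\<exists>p q. M s t = enat p \<and> M (r s) (r t) = enat q \<and> q dvd p"
    if "s \<in> T" "t \<in> T" "r s \<noteq> r t" for s t
    using odd(1)[OF that(1,2)] odd(1)[OF in_T in_T, OF that(1,2)] r(3) that by blast
  then show ?thesis using r(1,2) by blast
qed

lemma parabolic_retractable_if_compatible:
  assumes "finite S" "coxeter_matrix S M" "parabolic_retract_compatible S M"
  shows "parabolic_retractable S M"
  unfolding parabolic_retractable_def
proof (intro allI impI)
  fix X assume X: "X \<subseteq> S"
  obtain P where P: "partition_on S P" "\<forall>T\<in>P. retract_compatible T M"
    "\<forall>T\<in>P. \<forall>T'\<in>P. T \<noteq> T' \<longrightarrow> (\<exists>n. (n = \<infinity> \<or> (\<exists>k. n = enat k \<and> even k)) \<and>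
       (\<forall>a\<in>T. \<forall>b\<in>T'. M a b = n))"
    using assms(3) unfolding parabolic_retract_compatible_def by blast
  define good where "good T r \<longleftrightarrow> (\<forall>s\<in>T. r s \<in> X \<inter> T) \<and> (\<forall>s\<in>X \<inter> T. r s = s) \<and>
    (\<forall>s\<in>T. \<forall>t\<in>T. r s \<noteq> r t \<longrightarrow> (\<exists>p q. M s t = enat p \<and> M (r s) (r t) = enat q \<and> q dvd p))"
    for T r
  have "\<exists>r. good T r" if T: "T \<in> P" "X \<inter> T \<noteq> {}" for T
  proof -
    have "T \<subseteq> S" using T P(1) by (auto simp: partition_on_def)
    then have "finite T" "coxeter_matrix T M"
      using assms(1,2) by (auto simp: coxeter_matrix_def subset_iff intro: finite_subset)
    then show ?thesis
      unfolding good_def using retract_compatible_retraction[of T M "X \<inter> T"] P(2) T by auto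
  qed
  then obtain r where r: "good T (r T)" if "T \<in> P" "X \<inter> T \<noteq> {}" for T by metis
  have "\<exists>T. T \<in> P \<and> s \<in> T" if "s \<in> S" for s
    using that P(1) by (auto simp: partition_on_def)
  then obtain block where block: "block s \<in> P" "s \<in> block s" if "s \<in> S" for s by metis
  define g where "g s = (if X \<inter> block s = {} then None else Some (r (block s) s))" for s
  have into: "t \<in> X" if "s \<in> S" "g s = Some t" for s t
    using that r[of "block s"] block[of s] by (auto simp: g_def good_def split: if_splits)
  have "word_retraction S M X (rename_letters g)"
  proof (rule word_retraction_rename_letters[OF X into])
    fix s t assume "s \<in> S" "g s = Some t"
    then show "s \<in> S" "g s = Some t" .
  next
    fix s assume s: "s \<in> X"
    then have "s \<in> S" "X \<inter> block s \<noteq> {}" using X block[of s] by auto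
    then show "g s = Some s"
      using s r[of "block s"] block[of s] by (auto simp: g_def good_def)
  next
    fix s t m assume st: "s \<in> S" "t \<in> S" "s \<noteq> t" "M s t = enat m"
    show "artin_eq S M (rename_letters g (alt s t m)) (rename_letters g (alt t s m))"
    proof (cases "g s = None \<or> g t = None")
      case none: True
      show ?thesis
      proof (cases "block s = block t")
        case True
        then have "g s = None" "g t = None" using none by (auto simp: g_def split: if_splits)
        then show ?thesis by (simp add: rename_letters_alt_None artin_eq.refl)
      next
        case False
        then obtain n where "n = \<infinity> \<or> (\<exists>k. n = enat k \<and> even k)" "M s t = n"
          using P(3)[rule_format, OF block(1)[OF st(1)] block(1)[OF st(2)] False]
            block(2)[OF st(1)] block(2)[OF st(2)] by (elim exE conjE) simp
        then have "even m" using st(4) by auto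
        have in_S: "rename_letters g (alt s t m) \<in> words S"
          by (rule rename_letters_words[OF _ words_alt[OF st(1,2)]]) (use into X in blast)
        \<comment> \<open>Either both generators are killed, or one survives and occurs m / 2 times
          on both sides, as m is even.\<close>
        have "rename_letters g (alt s t m) = rename_letters g (alt t s m)"
        proof (cases "g s")
          case None
          then show ?thesis
            using \<open>even m\<close> rename_letters_alt_None[of g] rename_letters_alt_None_Some[of g s t]
            by (cases "g t") auto
        next
          case (Some x)
          then show ?thesis
            using \<open>even m\<close> none rename_letters_alt_None_Some[of g t s x m] by auto
        qed
        then show ?thesis using in_S by (simp add: artin_eq.refl)
      qed
    next
      case False
      then obtain x y where xy: "g s = Some x" "g t = Some y" by auto
      then have x: "x = r (block s) s" "X \<inter> block s \<noteq> {}" "good (block s) (r (block s))"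
        and y: "y = r (block t) t" "X \<inter> block t \<noteq> {}" "good (block t) (r (block t))"
        using r block st by (auto simp: g_def split: if_splits)
      have in_blocks: "x \<in> block s" "y \<in> block t" "x \<in> S" "y \<in> S"
        using x y block st X by (auto simp: good_def)
      show ?thesis
      proof (cases "x = y")
        case True
        then show ?thesis
          using xy in_blocks by (simp add: rename_letters_alt_Some artin_eq.refl words_alt)
      next
        case False
        have "\<exists>q. M x y = enat q \<and> q dvd m"
        proof (cases "block s = block t")
          case True
          then have "\<exists>p q. M s t = enat p \<and> M x y = enat q \<and> q dvd p"
            using x(1,3) y(1) \<open>x \<noteq> y\<close> block[OF st(1)] block[OF st(2)] by (simp add: good_def)
          then show ?thesis using st(4) by auto
        next
          case False
          obtain n where "\<forall>a\<in>block s. \<forall>b\<in>block t. M a b = n"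
            using P(3)[rule_format, OF block(1)[OF st(1)] block(1)[OF st(2)] False]
            by (elim exE conjE) blast
          \<comment> \<open>Images stay in their blocks and the entry between two blocks is
            constant, so the divisor sought is m itself.\<close>
          then have "M x y = M s t" using block(2) st(1,2) in_blocks by simp
          then show ?thesis using st(4) by simp
        qed
        then obtain q j where "M x y = enat q" "m = q * j" by (metis dvdE)
        then show ?thesis
          using xy in_blocks False by (simp add: rename_letters_alt_Some artin_eq_alt_mult)
      qed
    qed
  qed
  then show "has_retraction (artin_group S M) (parabolic_subgroup S M X)"
    using has_retraction_iff_word_retraction[OF X] by blast
qed

subsection \<open>Chebyshev polynomials\<close>

text \<open>The rescaled Chebyshev polynomial of the second kind U_(n-1)(x/2), with the index
  shifted so that the value at 0 is 0.\<close>

fun chebyshev :: "real \<Rightarrow> nat \<Rightarrow> real" where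
  "chebyshev x 0 = 0"
| "chebyshev x (Suc 0) = 1"
| "chebyshev x (Suc (Suc n)) = x * chebyshev x (Suc n) - chebyshev x n"

lemma chebyshev_2cos: "sin t * chebyshev (2 * cos t) n = sin (real n * t)"
proof (induction "2 * cos t" n rule: chebyshev.induct)
  case (3 n)
  have "sin t * chebyshev (2 * cos t) (Suc (Suc n)) =
      2 * cos t * (sin t * chebyshev (2 * cos t) (Suc n)) - sin t * chebyshev (2 * cos t) n"
    by (simp add: algebra_simps)
  also have "\<dots> = 2 * cos t * sin (real (Suc n) * t) - sin (real n * t)"
    using 3 by simp
  also have "\<dots> = sin (real (Suc (Suc n)) * t)"
  proof -
    have "sin (real (Suc (Suc n)) * t) = sin (real (Suc n) * t + t)"
      and "sin (real n * t) = sin (real (Suc n) * t - t)"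
      by (simp_all add: algebra_simps)
    then show ?thesis by (simp add: sin_add sin_diff)
  qed
  finally show ?case .
qed auto

lemma chebyshev_uminus: "\<bar>chebyshev (- x) n\<bar> = \<bar>chebyshev x n\<bar>"
proof -
  have "chebyshev (- x) n = (- 1) ^ Suc n * chebyshev x n"
    by (induction x n rule: chebyshev.induct) (auto simp: algebra_simps)
  then show ?thesis by (simp add: abs_mult)
qed

text \<open>For x \<ge> 2 the recurrence never lets the successive differences decrease, so the
  sequence grows strictly from 0; the induction carries this growth along.\<close>

lemma chebyshev_pos_if_ge_2:
  assumes "x \<ge> 2"
  shows "chebyshev x (Suc n) > 0"
proof -
  have "chebyshev x n < chebyshev x (Suc n) \<and> chebyshev x (Suc n) > 0"
  proof (induction n)
    case (Suc n)
    then have "2 * chebyshev x (Suc n) \<le> x * chebyshev x (Suc n)"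
      using assms by (intro mult_right_mono) auto
    then show ?case
      using conjunct1[OF Suc] conjunct2[OF Suc] unfolding chebyshev.simps by (intro conjI) linarith+
  qed simp
  then show ?thesis by simp
qed

lemma chebyshev_zero_imp_abs_less_2:
  assumes "chebyshev x k = 0" "k > 0"
  shows "\<bar>x\<bar> < 2"
proof (rule ccontr)
  assume "\<not> \<bar>x\<bar> < 2"
  then have "chebyshev \<bar>x\<bar> k > 0"
    using chebyshev_pos_if_ge_2[of "\<bar>x\<bar>" "k - 1"] assms(2) by simp
  moreover have "\<bar>chebyshev \<bar>x\<bar> k\<bar> = \<bar>chebyshev x k\<bar>"
    by (cases "x \<ge> 0") (auto simp: chebyshev_uminus)
  ultimately show False using assms(1) by simp
qed

context
  fixes p :: nat
  assumes p: "p \<ge> 2"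
begin

lemma sin_pi_div_pos: "sin (pi / p) > 0"
  using p pi_gt_zero by (intro sin_gt_zero) (auto simp: field_simps)

lemma chebyshev_eq_sin: "chebyshev (2 * cos (pi / p)) n = sin (n * pi / p) / sin (pi / p)"
  using chebyshev_2cos[of "pi / p" n] sin_pi_div_pos by (simp add: field_simps)

lemma chebyshev_order: "chebyshev (2 * cos (pi / p)) p = 0"
  using p by (simp add: chebyshev_eq_sin)

text \<open>The value is a quotient of sines whose numerator vanishes only when n / p is an
  integer.\<close>

lemma chebyshev_zero_imp_dvd:
  assumes "chebyshev (2 * cos (pi / p)) n = 0"
  shows "p dvd n"
proof -
  have "sin (n * pi / p) = 0"
    using assms sin_pi_div_pos by (simp add: chebyshev_eq_sin)
  then obtain i :: int where "n * pi / p = i * pi"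
    by (auto simp: sin_zero_iff_int2)
  then have "real n = i * real p"
    using p by (simp add: field_simps)
  then have "int n = i * int p"
    by (metis of_int_eq_iff of_int_mult of_int_of_nat_eq)
  then show ?thesis by (metis dvd_triv_right int_dvd_int_iff)
qed

lemma chebyshev_order_minus:
  assumes "j \<le> p"
  shows "chebyshev (2 * cos (pi / p)) (p - j) = chebyshev (2 * cos (pi / p)) j"
proof -
  have "real (p - j) * pi / p = pi - j * pi / p"
    using assms p by (simp add: field_simps of_nat_diff)
  then show ?thesis by (simp add: chebyshev_eq_sin)
qed

text \<open>The sine increases up to pi / 2, which settles the indices up to p / 2; the reflection j
  to p - j settles the others.\<close>

lemma chebyshev_ge_1:
  assumes "0 < j" "j < p"
  shows "chebyshev (2 * cos (pi / p)) j \<ge> 1"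
proof -
  have *: "chebyshev (2 * cos (pi / p)) j \<ge> 1" if "0 < j" "2 * j \<le> p" for j
  proof -
    have "sin (pi / p) \<le> sin (j * pi / p)"
    proof (rule sin_monotone_2pi_le)
      show "- (pi / 2) \<le> pi / p" by (rule order_trans[of _ 0]) simp_all
      have "1 * pi \<le> j * pi" using that(1) by (intro mult_right_mono) simp_all
      then show "pi / p \<le> j * pi / p" by (simp add: divide_right_mono)
      have "2 * real j \<le> real p" using that(2) by linarith
      then have "2 * real j * pi \<le> real p * pi" by (rule mult_right_mono) simp
      then show "j * pi / p \<le> pi / 2" using p by (simp add: field_simps)
    qed
    then show ?thesis using sin_pi_div_pos by (simp add: chebyshev_eq_sin)
  qed
  show ?thesis
  proof (cases "2 * j \<le> p")
    case True
    then show ?thesis using * assms by blast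
  next
    case False
    then have "chebyshev (2 * cos (pi / p)) (p - j) \<ge> 1" using assms by (intro *) auto
    then show ?thesis using chebyshev_order_minus[of j] assms by simp
  qed
qed

end

subsection \<open>Braid relations between transvections of the plane\<close>

fun alternate :: "('b \<Rightarrow> 'b) \<Rightarrow> ('b \<Rightarrow> 'b) \<Rightarrow> nat \<Rightarrow> 'b \<Rightarrow> 'b" where
  "alternate f g 0 = id"
| "alternate f g (Suc k) = f \<circ> alternate g f k"

fun shear1 :: "real \<Rightarrow> real \<times> real \<Rightarrow> real \<times> real" where
  "shear1 \<mu> (x, y) = (x + \<mu> * y, y)"

fun shear2 :: "real \<Rightarrow> real \<times> real \<Rightarrow> real \<times> real" where
  "shear2 \<mu> (x, y) = (x, y - \<mu> * x)"

fun quarter :: "real \<times> real \<Rightarrow> real \<times> real" where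
  "quarter (x, y) = (- y, x)"

text \<open>The matrix V of determinant 1 and trace \<mu>. Its powers have Chebyshev entries, and
  for \<mu> = 2 cos (pi / p) its p-th power is -1.\<close>

fun rotor :: "real \<Rightarrow> real \<times> real \<Rightarrow> real \<times> real" where
  "rotor \<mu> (x, y) = (\<mu> * x - y, x)"

lemma rotor_funpow:
  "(rotor \<mu> ^^ k) (x, y) =
     (chebyshev \<mu> (Suc k) * x - chebyshev \<mu> k * y,
      chebyshev \<mu> k * x + (chebyshev \<mu> (Suc k) - \<mu> * chebyshev \<mu> k) * y)"
  by (induction k) (auto simp: algebra_simps)

text \<open>With U = quarter and V = rotor \<open>\<mu>\<close> one has shear1 = V U^-1 and shear2 = U^-1 V, so the
  alternating products telescope to V^k U^-k and U^-1 V^k U^-k U.\<close>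

lemma alternate_shears:
  "alternate (shear1 \<mu>) (shear2 \<mu>) k ((quarter ^^ k) v) = (rotor \<mu> ^^ k) v"
  "quarter (alternate (shear2 \<mu>) (shear1 \<mu>) k ((quarter ^^ k) v)) = (rotor \<mu> ^^ k) (quarter v)"
proof (induction k arbitrary: v)
  case (Suc k)
  have quarter_Suc: "quarter ((quarter ^^ k) v) = (quarter ^^ k) (quarter v)" for v
    by (rule funpow_swap1)
  {
    case 1
    define z where "z = alternate (shear2 \<mu>) (shear1 \<mu>) k ((quarter ^^ k) (quarter v))"
    have "quarter z = (rotor \<mu> ^^ k) (quarter (quarter v))"
      unfolding z_def by (rule Suc)
    then have "shear1 \<mu> z = rotor \<mu> ((rotor \<mu> ^^ k) v)"
      by (cases v; cases z) (auto simp: rotor_funpow algebra_simps)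
    then show ?case by (simp only: quarter_Suc alternate.simps o_apply z_def funpow.simps)
  next
    case 2
    have "quarter (shear2 \<mu> w) = rotor \<mu> w" for w by (cases w) simp
    then show ?case by (simp only: quarter_Suc alternate.simps o_apply Suc(1) funpow.simps)
  }
qed auto

text \<open>With U = \<open>quarter\<close> and s = \<open>chebyshev \<mu>\<close>, Cayley-Hamilton
  writes V^k as s_k V - s_(k-1). Its commutator with U is therefore s_k times that of V with U,
  which vanishes only for \<mu> = 0.\<close>

lemma quarter_rotor_funpow_commute:
  "(\<forall>v. quarter ((rotor \<mu> ^^ k) v) = (rotor \<mu> ^^ k) (quarter v)) \<longleftrightarrow> \<mu> * chebyshev \<mu> k = 0"
proof
  assume "\<forall>v. quarter ((rotor \<mu> ^^ k) v) = (rotor \<mu> ^^ k) (quarter v)"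
  from spec[OF this, of "(1, 0)"] show "\<mu> * chebyshev \<mu> k = 0" by (simp add: rotor_funpow)
qed (auto simp: rotor_funpow algebra_simps)

text \<open>By \<open>alternate_shears\<close>, the braid relation precomposed with the surjective
  U^k says that V^k commutes with U.\<close>

lemma alternate_shears_eq_iff:
  "alternate (shear1 \<mu>) (shear2 \<mu>) k = alternate (shear2 \<mu>) (shear1 \<mu>) k
     \<longleftrightarrow> \<mu> = 0 \<or> chebyshev \<mu> k = 0"
proof -
  have inj: "quarter u = quarter v \<longleftrightarrow> u = v" for u v by (cases u; cases v) auto
  have "surj quarter" by (intro surjI[of _ "\<lambda>(x, y). (y, - x)"]) auto
  then have "surj (quarter ^^ k)" by (rule surj_fn)
  then have "alternate (shear1 \<mu>) (shear2 \<mu>) k = alternate (shear2 \<mu>) (shear1 \<mu>) k \<longleftrightarrow>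
      (\<forall>v. alternate (shear1 \<mu>) (shear2 \<mu>) k ((quarter ^^ k) v) =
           alternate (shear2 \<mu>) (shear1 \<mu>) k ((quarter ^^ k) v))"
    unfolding fun_eq_iff by (metis surjD)
  also have "\<dots> \<longleftrightarrow> (\<forall>v. quarter ((rotor \<mu> ^^ k) v) = (rotor \<mu> ^^ k) (quarter v))"
    by (subst inj[symmetric]) (simp only: alternate_shears)
  finally show ?thesis by (simp only: quarter_rotor_funpow_commute mult_eq_0_iff)
qed

lemma alternate_intertwine:
  assumes "\<And>v. f (L v) = L (f' v)" "\<And>v. g (L v) = L (g' v)"
  shows "alternate f g k (L v) = L (alternate f' g' k v)"
  using assms by (induction k arbitrary: f g f' g') auto

section \<open>Transvections along arbitrary vectors of the plane\<close>

fun det2 :: "real \<times> real \<Rightarrow> real \<times> real \<Rightarrow> real" where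
  "det2 (a, b) (x, y) = a * y - b * x"

definition transvection :: "real \<Rightarrow> real \<times> real \<Rightarrow> real \<times> real \<Rightarrow> real \<times> real" where
  "transvection \<mu> w v = (fst v + \<mu> * det2 w v * fst w, snd v + \<mu> * det2 w v * snd w)"

text \<open>If the symplectic product is nonzero, y and z form a basis. In its coordinates, given by
  \<open>L\<close>, the transvections are the two shears with parameter
  \<open>\<mu> * det2 y z\<close>.\<close>

lemma alternate_transvections_eqD:
  assumes "alternate (transvection \<mu> y) (transvection \<mu> z) k =
           alternate (transvection \<mu> z) (transvection \<mu> y) k"
  shows "\<mu> * det2 y z = 0 \<or> chebyshev (\<mu> * det2 y z) k = 0"
proof (cases "\<mu> * det2 y z = 0")
  case False
  obtain y1 y2 where y: "y = (y1, y2)" by (cases y)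
  obtain z1 z2 where z: "z = (z1, z2)" by (cases z)
  define L where "L v = (fst v * y1 + snd v * z1, fst v * y2 + snd v * z2)" for v :: "real \<times> real"
  define d where "d = y1 * z2 - y2 * z1"
  have d: "det2 y z = d" by (simp add: y z d_def)
  have L1: "transvection \<mu> y (L v) = L (shear1 (\<mu> * det2 y z) v)" for v
    by (cases v) (simp add: transvection_def L_def y z algebra_simps)
  have L2: "transvection \<mu> z (L v) = L (shear2 (\<mu> * det2 y z) v)" for v
    by (cases v) (simp add: transvection_def L_def y z algebra_simps)
  have coords: "fst v = (fst (L v) * z2 - snd (L v) * z1) / d" "snd v = (snd (L v) * y1 - fst (L v) * y2) / d"
    for v using False unfolding d by (auto simp: L_def d_def field_simps)
  have "inj L" by (rule injI) (metis coords prod.expand)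
  have "L (alternate (shear1 (\<mu> * det2 y z)) (shear2 (\<mu> * det2 y z)) k v) =
      L (alternate (shear2 (\<mu> * det2 y z)) (shear1 (\<mu> * det2 y z)) k v)" for v
    using fun_cong[OF assms, of "L v"] alternate_intertwine[of "transvection \<mu> y" L _ "transvection \<mu> z", OF L1 L2]
      alternate_intertwine[of "transvection \<mu> z" L _ "transvection \<mu> y", OF L2 L1] by simp
  then have "alternate (shear1 (\<mu> * det2 y z)) (shear2 (\<mu> * det2 y z)) k =
      alternate (shear2 (\<mu> * det2 y z)) (shear1 (\<mu> * det2 y z)) k"
    using \<open>inj L\<close> by (auto simp: inj_eq)
  then show ?thesis by (simp add: alternate_shears_eq_iff)
qed simp

subsection \<open>The gap for Hecke orbits\<close>

text \<open>The Hecke group generated by quarter and rotor acts on a Farey-like tessellation: up to sign and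
  quarter turns, every vector in the orbit of (1, 0) arises from a basis vector by the nonnegative
  matrices with columns \<open>V\<^sup>j (1, 0)\<close> and \<open>V\<^sup>j\<^sup>+\<^sup>1 (1, 0)\<close>. The Boolean distinguishes, for even p,
  the two orbits of shear1 and shear2.\<close>

inductive farey :: "nat \<Rightarrow> bool \<Rightarrow> real \<times> real \<Rightarrow> bool" for p where
  e1: "farey p False (1, 0)"
| e2: "farey p (even p) (0, 1)"
| step: "farey p c (x, y) \<Longrightarrow> Suc j < p \<Longrightarrow> farey p (c \<noteq> (even p \<and> odd j))
    (chebyshev (2 * cos (pi / p)) (Suc j) * x + chebyshev (2 * cos (pi / p)) (Suc (Suc j)) * y,
     chebyshev (2 * cos (pi / p)) j * x + chebyshev (2 * cos (pi / p)) (Suc j) * y)"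

text \<open>The quarter turns of Farey vectors. \<open>c \<noteq> even p\<close> flips the flag for
  even p and keeps it for odd p, where every flag is \<open>False\<close>.\<close>

inductive hecke_orbit :: "nat \<Rightarrow> bool \<Rightarrow> real \<times> real \<Rightarrow> bool" for p where
  "farey p c (x, y) \<Longrightarrow> hecke_orbit p c (x, y)"
| "farey p c (x, y) \<Longrightarrow> hecke_orbit p c (- x, - y)"
| "farey p c (x, y) \<Longrightarrow> hecke_orbit p (c \<noteq> even p) (- y, x)"
| "farey p c (x, y) \<Longrightarrow> hecke_orbit p (c \<noteq> even p) (y, - x)"

section \<open>Invariance of the Hecke orbits\<close>

lemma hecke_orbit_quarter:
  assumes "hecke_orbit p c w"
  shows "hecke_orbit p (c \<noteq> even p) (quarter w)"
proof -
  have flip: "((d \<noteq> even p) \<noteq> even p) = d" for d by auto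
  show ?thesis
    using assms by cases (simp_all only: flip quarter.simps minus_minus hecke_orbit.intros)
qed

lemma hecke_orbit_uminus:
  assumes "hecke_orbit p c (x, y)"
  shows "hecke_orbit p c (- x, - y)"
  using assms by cases (simp_all only: prod.inject minus_minus hecke_orbit.intros)

context
  fixes p :: nat and \<mu> :: real
  assumes p: "p \<ge> 3"
  defines "\<mu> \<equiv> 2 * cos (pi / p)"
begin

lemma chebyshev_pred_order: "Suc n = p \<Longrightarrow> chebyshev \<mu> n = 1"
  using chebyshev_order_minus[of p 1] p by (auto simp: \<mu>_def)

text \<open>V turns the step of index j into the step of index j + 1. After the last one, j + 2 = p,
  the relation V^p = -1 leaves a quarter turn of the parent vector.\<close>

lemma hecke_orbit_rotor_farey:
  assumes "farey p c w"
  shows "hecke_orbit p (c \<noteq> even p) (rotor \<mu> w)"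
  using assms
proof cases
  case e1
  have "farey p (even p \<noteq> (even p \<and> odd (0::nat))) (\<mu>, 1)"
    using step[OF e2, of 0] p by (simp add: \<mu>_def)
  then have "farey p (c \<noteq> even p) (\<mu>, 1)" using e1 by simp
  then show ?thesis using e1 hecke_orbit.intros(1) by simp
next
  case e2
  then show ?thesis using hecke_orbit.intros(2)[OF farey.e1[of p]] by simp
next
  case (step c' x y j)
  show ?thesis
  proof (cases "Suc (Suc j) < p")
    case True
    have "rotor \<mu> w = (chebyshev \<mu> (Suc (Suc j)) * x + chebyshev \<mu> (Suc (Suc (Suc j))) * y,
        chebyshev \<mu> (Suc j) * x + chebyshev \<mu> (Suc (Suc j)) * y)"
      using step by (simp add: \<mu>_def algebra_simps)
    moreover have "(c \<noteq> even p) = (c' \<noteq> (even p \<and> odd (Suc j)))" using step by auto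
    ultimately show ?thesis
      using hecke_orbit.intros(1)[OF farey.step[OF step(3) True]] unfolding \<mu>_def by simp
  next
    case False
    then have j: "Suc (Suc j) = p" using step by simp
    then have "chebyshev \<mu> (Suc (Suc j)) = 0" "chebyshev \<mu> (Suc j) = 1"
      using chebyshev_order[of p] chebyshev_pred_order[of "Suc j"] p by (auto simp: \<mu>_def simp del: chebyshev.simps)
    then have "rotor \<mu> w = (- y, x)"
      using step(2) by (simp add: \<mu>_def algebra_simps)
    moreover have "c' = c" using step(1) j by auto
    ultimately show ?thesis using hecke_orbit.intros(3)[OF step(3)] by simp
  qed
qed

lemma hecke_orbit_rotor:
  assumes "hecke_orbit p c w"
  shows "hecke_orbit p (c \<noteq> even p) (rotor \<mu> w)"
  using assms
proof cases
  case (1 x y)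
  then show ?thesis using hecke_orbit_rotor_farey by blast
next
  case (2 x y)
  then show ?thesis
    using hecke_orbit_uminus[of p _ "\<mu> * x - y" x] hecke_orbit_rotor_farey[of c "(x, y)"] by simp
next
  \<comment> \<open>Here V U is minus \<open>shear1 \<mu>\<close>, and \<open>shear1 \<mu>\<close>
    is the Farey step of index 0.\<close>
  case (3 d x y)
  have "farey p d (x + \<mu> * y, y)" using step[OF 3(3), of 0] p by (simp add: \<mu>_def)
  moreover have "(c \<noteq> even p) = d" using 3(1) by auto
  ultimately have "hecke_orbit p (c \<noteq> even p) (- (x + \<mu> * y), - y)" using hecke_orbit.intros(2) by blast
  moreover have "rotor \<mu> w = (- (x + \<mu> * y), - y)" using 3(2) by simp
  ultimately show ?thesis by (simp only:)
next
  case (4 d x y)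
  have "farey p d (x + \<mu> * y, y)" using step[OF 4(3), of 0] p by (simp add: \<mu>_def)
  moreover have "(c \<noteq> even p) = d" using 4(1) by auto
  ultimately have "hecke_orbit p (c \<noteq> even p) (x + \<mu> * y, y)" using hecke_orbit.intros(1) by blast
  then show ?thesis using 4(2) by (simp add: add.commute)
qed

lemma hecke_orbit_rotor_funpow:
  "hecke_orbit p c w \<Longrightarrow> hecke_orbit p (c \<noteq> (even p \<and> odd n)) ((rotor \<mu> ^^ n) w)"
proof (induction n)
  case (Suc n)
  have "((c \<noteq> (even p \<and> odd n)) \<noteq> even p) = (c \<noteq> (even p \<and> odd (Suc n)))" by auto
  then show ?case using hecke_orbit_rotor[OF Suc.IH[OF Suc.prems]] by simp
qed simp

text \<open>As V^p = -1, the inverse of V is -V^(p-1).\<close>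

lemma hecke_orbit_rotor_inverse:
  assumes "hecke_orbit p c (x, y)"
  shows "hecke_orbit p (c \<noteq> even p) (y, \<mu> * y - x)"
proof -
  have "chebyshev \<mu> p = 0" "chebyshev \<mu> (p - 1) = 1" "Suc (p - 1) = p"
    using chebyshev_order[of p] chebyshev_pred_order[of "p - 1"] p by (auto simp: \<mu>_def)
  then have "(rotor \<mu> ^^ (p - 1)) (x, y) = (- y, x - \<mu> * y)"
    by (simp add: rotor_funpow)
  moreover have "(c \<noteq> (even p \<and> odd (p - 1))) = (c \<noteq> even p)" using p by auto
  ultimately show ?thesis
    using hecke_orbit_uminus[of p _ "- y" "x - \<mu> * y"] hecke_orbit_rotor_funpow[OF assms, of "p - 1"]
    by simp
qed

text \<open>The shears are V U^-1 and U^-1 V. Each is a product of two maps that change the flag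
  alike, so the flag is preserved.\<close>

lemma hecke_orbit_shears:
  assumes "hecke_orbit p c w"
  shows "hecke_orbit p c (shear1 \<mu> w)" "hecke_orbit p c (shear1 (- \<mu>) w)"
    "hecke_orbit p c (shear2 \<mu> w)" "hecke_orbit p c (shear2 (- \<mu>) w)"
proof -
  obtain x y where w: "w = (x, y)" by (cases w)
  have flip: "((c \<noteq> even p) \<noteq> even p) = c" by auto
  have quarter_inv: "hecke_orbit p (c' \<noteq> even p) (b, - a)" if "hecke_orbit p c' (a, b)" for c' a b
    using hecke_orbit_quarter[OF hecke_orbit_uminus[OF that]] by simp
  show "hecke_orbit p c (shear1 \<mu> w)"
    using hecke_orbit_rotor[OF quarter_inv[OF assms[unfolded w]]] by (simp only: flip) (simp add: w add.commute)
  show "hecke_orbit p c (shear2 \<mu> w)"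
    using quarter_inv[of "c \<noteq> even p" "\<mu> * x - y" x] hecke_orbit_rotor[OF assms[unfolded w]]
    by (simp only: flip) (simp add: w)
  show "hecke_orbit p c (shear1 (- \<mu>) w)"
    using hecke_orbit_quarter[OF hecke_orbit_rotor_inverse[OF assms[unfolded w]]]
    by (simp only: flip) (simp add: w)
  have "hecke_orbit p c (- x, \<mu> * - x - y)"
    using hecke_orbit_rotor_inverse[OF quarter_inv[OF assms[unfolded w]]] by (simp only: flip)
  from hecke_orbit_uminus[OF this] show "hecke_orbit p c (shear2 (- \<mu>) w)"
    by (simp add: w add.commute)
qed

section \<open>The possible coordinates of orbit vectors\<close>

lemma mu_bounds: "1 \<le> \<mu>" "\<mu> \<le> 2"
proof -
  have "cos (pi / 3) \<le> cos (pi / p)"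
    using p pi_gt_zero by (intro cos_monotone_0_pi_le) (auto simp: field_simps)
  then show "1 \<le> \<mu>" by (simp add: \<mu>_def cos_60)
  show "\<mu> \<le> 2" by (simp add: \<mu>_def)
qed

text \<open>The value is 1 at both ends. In between, the recurrence expresses
  \<open>\<mu> * chebyshev \<mu> j\<close> as the sum of the two neighbours, each at least
  1.\<close>

lemma chebyshev_gap:
  assumes "0 < j" "j < p"
  shows "chebyshev \<mu> j = 1 \<or> \<mu> * chebyshev \<mu> j \<ge> 2"
proof (cases "j = 1 \<or> Suc j = p")
  case True
  then show ?thesis using chebyshev_pred_order by auto
next
  case False
  then obtain i where i: "j = Suc i" "0 < i" "Suc (Suc i) < p" using assms by (cases j) auto
  have "chebyshev \<mu> i \<ge> 1" "chebyshev \<mu> (Suc (Suc i)) \<ge> 1"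
    using chebyshev_ge_1[of p] i p by (auto simp: \<mu>_def simp del: chebyshev.simps)
  then show ?thesis using i(1) by simp
qed

text \<open>The bound 2 is that of \<open>chebyshev_zero_imp_abs_less_2\<close>: in the third case
  \<open>\<mu> * t\<close> is not a zero of any \<open>chebyshev\<close> polynomial of positive
  index.\<close>

definition gap :: "real \<Rightarrow> bool" where
  "gap t \<longleftrightarrow> t = 0 \<or> t = 1 \<or> \<mu> * t \<ge> 2"

lemma gap_ge_1:
  assumes "gap t" "t \<noteq> 0" "t \<ge> 0"
  shows "t \<ge> 1"
proof -
  have "\<mu> * t \<le> 2 * t" using mu_bounds(2) assms(3) by (rule mult_right_mono)
  moreover have "t = 1 \<or> \<mu> * t \<ge> 2" using assms(1,2) by (simp add: gap_def)
  ultimately show ?thesis by linarith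
qed

text \<open>A new coordinate is a sum of two terms \<open>\<ge> 1\<close> unless the old vector lies on an axis,
  in which case it is one of the Chebyshev values.\<close>

lemma gap_combine:
  assumes "gap x" "gap y" "x \<ge> 0" "y \<ge> 0" "x = 0 \<longrightarrow> y = 1" "y = 0 \<longrightarrow> x = 1"
    "a = 0 \<and> b = 1 \<or> a = 1 \<and> b = 0 \<or> a \<ge> 1 \<and> b \<ge> 1" "gap a" "gap b"
  shows "gap (a * x + b * y)"
proof (cases "x = 0 \<or> y = 0 \<or> a = 0 \<or> b = 0")
  case True
  then show ?thesis using assms by auto
next
  case False
  then have "a \<ge> 1" "b \<ge> 1" "x \<ge> 1" "y \<ge> 1" using assms gap_ge_1 by auto
  then have "a * x \<ge> 1" "b * y \<ge> 1"
    using mult_mono[of 1 a 1 x] mult_mono[of 1 b 1 y] by auto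
  then have "a * x + b * y \<ge> 2" by simp
  then have "\<mu> * (a * x + b * y) \<ge> 2"
    using mu_bounds mult_mono[of 1 \<mu> 2 "a * x + b * y"] by auto
  then show ?thesis by (simp add: gap_def)
qed

lemma gap_chebyshev: "j \<le> p \<Longrightarrow> gap (chebyshev \<mu> j)"
  using chebyshev_gap[of j] chebyshev_order[of p] p by (cases "j = 0 \<or> j = p") (auto simp: gap_def \<mu>_def)

text \<open>The clauses on zero coordinates say that a vector on an axis is a basis vector with the
  flag of that basis vector. \<open>gap_combine\<close> needs the first part, and the flags later
  tell the two orbits for even p apart.\<close>

lemma farey_gap:
  assumes "farey p c w"
  shows "fst w \<ge> 0 \<and> snd w \<ge> 0 \<and> gap (fst w) \<and> gap (snd w) \<and>
    (fst w = 0 \<longrightarrow> snd w = 1 \<and> c = even p) \<and> (snd w = 0 \<longrightarrow> fst w = 1 \<and> \<not> c)"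
  using assms
proof induction
  case (step c x y j)
  let ?s = "chebyshev \<mu>"
  have x: "x \<ge> 0" "gap x" "x = 0 \<longrightarrow> y = 1 \<and> c = even p"
    and y: "y \<ge> 0" "gap y" "y = 0 \<longrightarrow> x = 1 \<and> \<not> c" using step.IH by auto
  have s1: "?s (Suc j) \<ge> 1" using chebyshev_ge_1[of p "Suc j"] step p by (simp add: \<mu>_def)
  have s0: "?s j \<ge> 1 \<or> j = 0"
    using chebyshev_ge_1[of p j] step p by (auto simp: \<mu>_def)
  have s2: "?s (Suc (Suc j)) \<ge> 1 \<or> Suc (Suc j) = p"
    using chebyshev_ge_1[of p "Suc (Suc j)"] step p by (auto simp: \<mu>_def simp del: chebyshev.simps)
  have sp: "?s (Suc (Suc j)) = 0" "?s (Suc j) = 1" if "Suc (Suc j) = p"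
  proof -
    show "?s (Suc (Suc j)) = 0" unfolding that \<mu>_def using p by (intro chebyshev_order) simp
    show "?s (Suc j) = 1" using that by (rule chebyshev_pred_order)
  qed
  have g: "gap (?s j)" "gap (?s (Suc j))" "gap (?s (Suc (Suc j)))"
    using step.hyps(2) by (intro gap_chebyshev; linarith)+
  have gx: "gap (?s (Suc j) * x + ?s (Suc (Suc j)) * y)"
  proof (rule gap_combine[OF x(2) y(2) x(1) y(1)])
    show "?s (Suc j) = 0 \<and> ?s (Suc (Suc j)) = 1 \<or> ?s (Suc j) = 1 \<and> ?s (Suc (Suc j)) = 0 \<or>
        ?s (Suc j) \<ge> 1 \<and> ?s (Suc (Suc j)) \<ge> 1"
      using s1 s2 sp by blast
  qed (use x(3) y(3) g in blast)+
  have gy: "gap (?s j * x + ?s (Suc j) * y)"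
  proof (rule gap_combine[OF x(2) y(2) x(1) y(1)])
    show "?s j = 0 \<and> ?s (Suc j) = 1 \<or> ?s j = 1 \<and> ?s (Suc j) = 0 \<or> ?s j \<ge> 1 \<and> ?s (Suc j) \<ge> 1"
      using s1 s0 by auto
  qed (use x(3) y(3) g in blast)+
  have nn: "?s j \<ge> 0" "?s (Suc j) > 0" "?s (Suc (Suc j)) \<ge> 0"
  proof -
    show "?s j \<ge> 0" using s0 by (elim disjE) simp_all
    show "?s (Suc j) > 0" using s1 by linarith
    show "?s (Suc (Suc j)) \<ge> 0" using s2
    proof
      assume "Suc (Suc j) = p"
      then show ?thesis using sp(1) by (simp only:)
    qed linarith
  qed
  have px: "?s (Suc j) * x \<ge> 0" "?s (Suc (Suc j)) * y \<ge> 0" "?s j * x \<ge> 0" "?s (Suc j) * y \<ge> 0"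
    using nn x(1) y(1) by (auto simp del: chebyshev.simps intro!: mult_nonneg_nonneg)
  \<comment> \<open>A new zero coordinate forces the old vector onto an axis and the step to be the
    last one (\<open>zx\<close>) or the first one (\<open>zy\<close>). For even p both have even
    index, so the flag stays.\<close>
  have zx: "?s j * x + ?s (Suc j) * y = 1 \<and> (c \<noteq> (even p \<and> odd j)) = even p"
    if "?s (Suc j) * x + ?s (Suc (Suc j)) * y = 0"
  proof -
    have "?s (Suc j) * x = 0" "?s (Suc (Suc j)) * y = 0" using that px by linarith+
    then have "x = 0" using nn(2) by simp
    then have "y = 1" "c = even p" using x by auto
    have "?s (Suc (Suc j)) = 0" using \<open>?s (Suc (Suc j)) * y = 0\<close> \<open>y = 1\<close> by (simp only: mult_1_right)
    then have j: "Suc (Suc j) = p" using s2 by linarith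
    then have "(c \<noteq> (even p \<and> odd j)) = even p" using \<open>c = even p\<close> by auto
    then show ?thesis using sp(2)[OF j] \<open>x = 0\<close> \<open>y = 1\<close> by simp
  qed
  have zy: "?s (Suc j) * x + ?s (Suc (Suc j)) * y = 1 \<and> \<not> (c \<noteq> (even p \<and> odd j))"
    if "?s j * x + ?s (Suc j) * y = 0"
  proof -
    have "?s j * x = 0" "?s (Suc j) * y = 0" using that px by linarith+
    then have "y = 0" using nn(2) by simp
    then have "x = 1" "\<not> c" using y by auto
    then have "j = 0" using s0 \<open>?s j * x = 0\<close> by simp
    then show ?thesis using \<open>x = 1\<close> \<open>y = 0\<close> \<open>\<not> c\<close> by auto
  qed
  show ?case
    unfolding \<mu>_def[symmetric] fst_conv snd_conv
    by (intro conjI impI gx gy) (use px zx zy in \<open>blast intro: add_nonneg_nonneg\<close>)+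
qed (auto simp: gap_def)

text \<open>For even p a vector with first coordinate 0 is, up to sign, (0, 1) and carries the flag
  \<open>True\<close>; this excludes it here.\<close>

lemma hecke_orbit_gap:
  assumes "hecke_orbit p c w" "\<not> c"
  shows "(fst w = 0 \<or> \<bar>fst w\<bar> = 1 \<or> \<mu> * \<bar>fst w\<bar> \<ge> 2) \<and>
    (snd w = 0 \<or> \<bar>snd w\<bar> = 1 \<or> \<mu> * \<bar>snd w\<bar> \<ge> 2) \<and>
    (snd w = 0 \<longrightarrow> \<bar>fst w\<bar> = 1) \<and> (even p \<longrightarrow> fst w \<noteq> 0)"
  using assms(1)
proof cases
  case (1 a b)
  then show ?thesis using farey_gap[OF 1(2)] assms(2) by (auto simp: gap_def)
next
  case (2 a b)
  then show ?thesis using farey_gap[OF 2(2)] assms(2) by (auto simp: gap_def)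
next
  case (3 d a b)
  then show ?thesis using farey_gap[OF 3(3)] assms(2) by (auto simp: gap_def)
next
  case (4 d a b)
  then show ?thesis using farey_gap[OF 4(3)] assms(2) by (auto simp: gap_def)
qed

end

subsection \<open>The symplectic representation\<close>

text \<open>\<open>form_braid\<close> is what makes transvections satisfy the braid relations:
  orthogonal ones commute, and otherwise a Chebyshev zero gives the relation of length m. Infinite
  entries impose nothing.\<close>

locale artin_form =
  fixes S :: "'a set" and M :: "'a \<Rightarrow> 'a \<Rightarrow> enat" and b :: "'a \<Rightarrow> 'a \<Rightarrow> real"
  assumes finite_S: "finite S"
    and form_anti: "s \<in> S \<Longrightarrow> t \<in> S \<Longrightarrow> b t s = - b s t"
    and form_braid: "s \<in> S \<Longrightarrow> t \<in> S \<Longrightarrow> s \<noteq> t \<Longrightarrow> M s t = enat m \<Longrightarrow>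
      m = 2 \<and> b s t = 0 \<or> b s t \<noteq> 0 \<and> chebyshev (b s t) m = 0"
begin

definition pairing :: "'a \<Rightarrow> ('a \<Rightarrow> real) \<Rightarrow> real" where
  "pairing s v = (\<Sum>t\<in>S. b s t * v t)"

definition transv :: "real \<Rightarrow> 'a \<Rightarrow> ('a \<Rightarrow> real) \<Rightarrow> 'a \<Rightarrow> real" where
  "transv e s v = v(s := v s + e * pairing s v)"

fun act :: "'a word \<Rightarrow> ('a \<Rightarrow> real) \<Rightarrow> 'a \<Rightarrow> real" where
  "act [] = id"
| "act ((s, e) # w) = transv (if e then 1 else - 1) s \<circ> act w"

lemma form_self: "s \<in> S \<Longrightarrow> b s s = 0"
  using form_anti[of s s] by simp

lemma pairing_upd:
  assumes "u \<in> S"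
  shows "pairing s (v(u := v u + d)) = pairing s v + b s u * d"
proof -
  have "pairing s (v(u := v u + d)) = (\<Sum>t\<in>S. b s t * v t + (if t = u then b s u * d else 0))"
    unfolding pairing_def by (rule sum.cong) (auto simp: algebra_simps)
  also have "\<dots> = pairing s v + b s u * d"
    using assms finite_S by (simp add: sum.distrib sum.delta pairing_def)
  finally show ?thesis .
qed

lemma pairing_transv:
  "u \<in> S \<Longrightarrow> pairing s (transv e u v) = pairing s v + b s u * (e * pairing u v)"
  unfolding transv_def by (rule pairing_upd)

lemma transv_inverse:
  assumes "s \<in> S"
  shows "transv e s (transv (- e) s v) = v"
  unfolding transv_def[of e s "transv (- e) s v"] pairing_transv[OF assms] form_self[OF assms]
  by (simp add: transv_def)

lemma transv_commute:
  assumes "s \<in> S" "t \<in> S" "b s t = 0"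
  shows "transv e s (transv e' t v) = transv e' t (transv e s v)"
proof -
  have "b t s = 0" using form_anti[OF assms(1,2)] assms(3) by simp
  then show ?thesis
    unfolding transv_def[of e s "transv e' t v"] transv_def[of e' t "transv e s v"]
      pairing_transv[OF assms(1)] pairing_transv[OF assms(2)] assms(3)
    by (auto simp: transv_def fun_eq_iff)
qed

lemma act_append: "act (u @ v) = act u \<circ> act v"
proof (induction u)
  case (Cons l u)
  then show ?case by (cases l) (simp add: o_assoc)
qed simp

lemma act_alt: "act (alt s t m) = alternate (transv 1 s) (transv 1 t) m"
  by (induction m arbitrary: s t) auto

text \<open>Both transvections preserve the affine plane through v in the directions s and t. If
  \<open>b s t\<close> is nonzero, they act on it as the two shears.\<close>

lemma alternate_transv_eq:
  assumes "s \<in> S" "t \<in> S" "s \<noteq> t" "M s t = enat m"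
  shows "alternate (transv 1 s) (transv 1 t) m = alternate (transv 1 t) (transv 1 s) m"
proof (cases "b s t = 0")
  case True
  then have "m = Suc (Suc 0)" using form_braid[OF assms] by simp
  then show ?thesis using transv_commute[OF assms(1,2) True] by auto
next
  case False
  define \<mu> where "\<mu> = b s t"
  have \<mu>: "\<mu> \<noteq> 0" "b s t = \<mu>" "b t s = - \<mu>" "chebyshev \<mu> m = 0"
    using False form_anti[OF assms(1,2)] form_braid[OF assms] by (auto simp: \<mu>_def)
  have eq: "alternate (shear1 \<mu>) (shear2 \<mu>) m = alternate (shear2 \<mu>) (shear1 \<mu>) m"
    using \<mu> by (simp add: alternate_shears_eq_iff)
  show ?thesis
  proof
    fix v :: "'a \<Rightarrow> real"
    define v1 where "v1 d = v(s := v s + d)" for d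
    \<comment> \<open>Coordinates on this affine plane, with the origin moved to the point where the
      pairings with s and t both vanish.\<close>
    define L where "L q = (v1 (fst q + pairing t v / \<mu>))
      (t := v1 (fst q + pairing t v / \<mu>) t + (snd q - pairing s v / \<mu>))" for q
    have ps: "pairing s (L q) = \<mu> * snd q" for q
      unfolding L_def pairing_upd[OF assms(2)] v1_def pairing_upd[OF assms(1)]
      using \<mu> by (simp add: form_self assms field_simps)
    have pt: "pairing t (L q) = - \<mu> * fst q" for q
      unfolding L_def pairing_upd[OF assms(2)] v1_def pairing_upd[OF assms(1)]
      using \<mu> by (simp add: form_self assms field_simps)
    have Ls: "transv 1 s (L q) = L (shear1 \<mu> q)" for q
      unfolding transv_def ps using assms(3) by (cases q) (auto simp: L_def v1_def fun_eq_iff)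
    have Lt: "transv 1 t (L q) = L (shear2 \<mu> q)" for q
      unfolding transv_def pt using assms(3) by (cases q) (auto simp: L_def v1_def fun_eq_iff)
    have v: "v = L (- pairing t v / \<mu>, pairing s v / \<mu>)"
      by (simp add: L_def v1_def fun_eq_iff)
    show "alternate (transv 1 s) (transv 1 t) m v = alternate (transv 1 t) (transv 1 s) m v"
      apply (subst (1 2) v)
      using alternate_intertwine[of "transv 1 s" L _ "transv 1 t", OF Ls Lt]
        alternate_intertwine[of "transv 1 t" L _ "transv 1 s", OF Lt Ls] eq by simp
  qed
qed

lemma act_artin_eq: "artin_eq S M u v \<Longrightarrow> act u = act v"
proof (induction rule: artin_eq.induct)
  case (cancel u v s e)
  have "act [(s, e), (s, \<not> e)] = id"
    using transv_inverse[OF cancel(3), of 1] transv_inverse[OF cancel(3), of "- 1"]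
    by (auto simp: fun_eq_iff)
  then show ?case by (simp only: act_append id_o o_id)
next
  case (braid u v s t m)
  show ?case using alternate_transv_eq[OF braid(3-6)] by (simp only: act_append act_alt)
qed auto

lemma surj_act:
  assumes "w \<in> words S"
  shows "surj (act w)"
  using assms
proof (induction w)
  case (Cons l w)
  obtain s e where l: "l = (s, e)" by (cases l)
  have "surj (transv d s)" for d
    using transv_inverse[of s d] Cons.prems l by (intro surjI[of _ "transv (- d) s"]) auto
  moreover have "surj (act w)" using Cons by simp
  ultimately show ?case unfolding l act.simps by (metis comp_surj)
qed simp

lemma act_commute_transv:
  assumes "w \<in> words {a, c}" "a \<in> S" "c \<in> S" "b a c = 0" "s \<in> {a, c}"
  shows "act w (transv d s v) = transv d s (act w v)"
  using assms(1)
proof (induction w)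
  case (Cons l w)
  obtain t e where l: "l = (t, e)" by (cases l)
  have "b t s = 0" "t \<in> S" "s \<in> S"
    using assms Cons.prems l form_self form_anti[of a c] by auto
  then show ?case using Cons l by (simp add: transv_commute)
qed simp

section \<open>The plane spanned by two generators\<close>

fun plane :: "'a \<Rightarrow> 'a \<Rightarrow> real \<times> real \<Rightarrow> 'a \<Rightarrow> real" where
  "plane a c (x, y) = (\<lambda>t. if t = a then x else if t = c then y else 0)"

lemma plane_inj:
  assumes "a \<noteq> c" "plane a c u = plane a c v"
  shows "u = v"
proof -
  have "fst q = plane a c q a" "snd q = plane a c q c" for q
    using assms(1) by (cases q; simp)+
  then show ?thesis using assms(2) by (metis prod.expand)
qed

lemma pairing_plane:
  assumes "a \<in> S" "c \<in> S" "a \<noteq> c"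
  shows "pairing s (plane a c (x, y)) = b s a * x + b s c * y"
proof -
  have "pairing s (plane a c (x, y)) =
      (\<Sum>t\<in>S. (if t = a then b s a * x else 0) + (if t = c then b s c * y else 0))"
    unfolding pairing_def using assms(3) by (intro sum.cong) auto
  then show ?thesis using assms finite_S by (simp add: sum.distrib sum.delta)
qed

end

text \<open>The action of words in a and c in the coordinates of \<open>plane a c\<close>; each
  letter other than a is read as c.\<close>

fun plane_act :: "'a \<Rightarrow> real \<Rightarrow> 'a word \<Rightarrow> real \<times> real \<Rightarrow> real \<times> real" where
  "plane_act a \<mu> [] = id"
| "plane_act a \<mu> ((s, e) # w) =
     (if s = a then shear1 else shear2) (if e then \<mu> else - \<mu>) \<circ> plane_act a \<mu> w"

lemma (in artin_form) act_plane:
  assumes "w \<in> words {a, c}" "a \<in> S" "c \<in> S" "a \<noteq> c"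
  shows "act w (plane a c v) = plane a c (plane_act a (b a c) w v)"
  using assms(1)
proof (induction w)
  case (Cons l w)
  obtain t e where l: "l = (t, e)" by (cases l)
  obtain x y where xy: "plane_act a (b a c) w v = (x, y)" by (cases "plane_act a (b a c) w v")
  have w: "act w (plane a c v) = plane a c (x, y)" using Cons xy by (simp del: plane.simps)
  have pa: "transv d a (plane a c (x, y)) = plane a c (x + d * b a c * y, y)" for d
    unfolding transv_def pairing_plane[OF assms(2-4)] form_self[OF assms(2)] by auto
  have pc: "transv d c (plane a c (x, y)) = plane a c (x, y - d * b a c * x)" for d
    unfolding transv_def pairing_plane[OF assms(2-4)] form_self[OF assms(3)] form_anti[OF assms(2,3)]
    using assms(4) by auto
  have "t = a \<or> t = c" using Cons.prems l by simp
  then show ?case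
    using assms(4) by (auto simp: l w xy pa pc simp del: plane.simps)
qed simp

lemma plane_act_matrix:
  "\<exists>\<alpha> \<beta> \<gamma> \<delta>. \<alpha> * \<delta> - \<beta> * \<gamma> = 1 \<and>
     (\<forall>x y. plane_act a \<mu> w (x, y) = (\<alpha> * x + \<beta> * y, \<gamma> * x + \<delta> * y))"
proof (induction w)
  case Nil
  show ?case by (intro exI[of _ 1] exI[of _ 0]) auto
next
  case (Cons l w)
  obtain t e where l: "l = (t, e)" by (cases l)
  obtain \<alpha> \<beta> \<gamma> \<delta> where m: "\<alpha> * \<delta> - \<beta> * \<gamma> = 1"
    "\<And>x y. plane_act a \<mu> w (x, y) = (\<alpha> * x + \<beta> * y, \<gamma> * x + \<delta> * y)"
    using Cons by blast
  define \<nu> where "\<nu> = (if e then \<mu> else - \<mu>)"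
  show ?case
  proof (cases "t = a")
    case True
    have "plane_act a \<mu> (l # w) (x, y) =
        ((\<alpha> + \<nu> * \<gamma>) * x + (\<beta> + \<nu> * \<delta>) * y, \<gamma> * x + \<delta> * y)" for x y
      using True l m(2) by (simp add: \<nu>_def algebra_simps)
    moreover have "(\<alpha> + \<nu> * \<gamma>) * \<delta> - (\<beta> + \<nu> * \<delta>) * \<gamma> = 1" using m(1) by (simp add: algebra_simps)
    ultimately show ?thesis by blast
  next
    case False
    have "plane_act a \<mu> (l # w) (x, y) =
        (\<alpha> * x + \<beta> * y, (\<gamma> - \<nu> * \<alpha>) * x + (\<delta> - \<nu> * \<beta>) * y)" for x y
      using False l m(2) by (simp add: \<nu>_def algebra_simps)
    moreover have "\<alpha> * (\<delta> - \<nu> * \<beta>) - \<beta> * (\<gamma> - \<nu> * \<alpha>) = 1" using m(1) by (simp add: algebra_simps)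
    ultimately show ?thesis by blast
  qed
qed

lemma shear1_eq_transvection: "shear1 \<mu> = transvection \<mu> (1, 0)"
  by (auto simp: transvection_def)

lemma shear2_eq_transvection: "shear2 \<mu> = transvection \<mu> (0, 1)"
  by (auto simp: transvection_def)

text \<open>A map of determinant 1 preserves the symplectic product, so it conjugates the
  transvection along (1, 0) into the one along the image of (1, 0).\<close>

lemma conjugate_shear_eq_transvection:
  assumes "\<And>v. X (plane_act a \<mu> h v) = plane_act a \<mu> h (shear1 \<mu> v)"
  shows "X = transvection \<mu> (plane_act a \<mu> h (1, 0))"
proof -
  obtain \<alpha> \<beta> \<gamma> \<delta> where det: "\<alpha> * \<delta> - \<beta> * \<gamma> = 1"
    and H: "\<And>x y. plane_act a \<mu> h (x, y) = (\<alpha> * x + \<beta> * y, \<gamma> * x + \<delta> * y)"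
    using plane_act_matrix by metis
  have "X (x, y) = transvection \<mu> (\<alpha>, \<gamma>) (x, y)" for x y
  proof -
    \<comment> \<open>The preimage of (x, y), computed with the adjugate matrix.\<close>
    define x' y' where "x' = \<delta> * x - \<beta> * y" and "y' = \<alpha> * y - \<gamma> * x"
    have "\<alpha> * x' + \<beta> * y' = (\<alpha> * \<delta> - \<beta> * \<gamma>) * x" "\<gamma> * x' + \<delta> * y' = (\<alpha> * \<delta> - \<beta> * \<gamma>) * y"
      by (simp_all add: x'_def y'_def algebra_simps)
    then have xy: "x = \<alpha> * x' + \<beta> * y'" "y = \<gamma> * x' + \<delta> * y'" by (simp_all add: det)
    have "X (x, y) = plane_act a \<mu> h (x' + \<mu> * y', y')"
      using assms[of "(x', y')"] by (simp add: H xy)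
    also have "\<dots> = (x + \<mu> * y' * \<alpha>, y + \<mu> * y' * \<gamma>)"
      unfolding H xy by (simp add: algebra_simps)
    finally show ?thesis by (simp add: transvection_def y'_def)
  qed
  then show ?thesis using H[of 1 0] by auto
qed

lemma plane_act_hecke_orbit:
  assumes "p \<ge> 3"
  shows "hecke_orbit p False (plane_act a (2 * cos (pi / p)) w (1, 0))"
proof (induction w)
  case Nil
  show ?case using hecke_orbit.intros(1)[OF farey.e1] by simp
next
  case (Cons l w)
  then show ?case using hecke_orbit_shears[OF assms Cons] by (cases l) auto
qed

text \<open>For \<mu> = 2 the shears are integral and congruent to the identity mod 2. This parity
  replaces the Hecke gap when the entry is infinite.\<close>

lemma plane_act_2_parity:
  "\<exists>i j :: int. plane_act a 2 w (1, 0) = (real_of_int i, real_of_int j) \<and> odd i \<and> even j"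
proof (induction w)
  case Nil
  show ?case by (intro exI[of _ 1] exI[of _ 0]) simp
next
  case (Cons l w)
  then obtain i j :: int where ij: "plane_act a 2 w (1, 0) = (real_of_int i, real_of_int j)" "odd i" "even j"
    by blast
  obtain t e where l: "l = (t, e)" by (cases l)
  define n :: int where "n = (if e then 2 else - 2)"
  have n: "real_of_int n = (if e then 2 else - 2)" "even n" by (auto simp: n_def)
  show ?case
  proof (cases "t = a")
    case True
    then show ?thesis using ij l n by (intro exI[of _ "i + n * j"] exI[of _ j]) auto
  next
    case False
    then show ?thesis using ij l n by (intro exI[of _ i] exI[of _ "j - n * i"]) auto
  qed
qed

subsection \<open>Retractions in the symplectic representation\<close>

definition cox_weight :: "enat \<Rightarrow> real" where
  "cox_weight m = (case m of enat k \<Rightarrow> 2 * cos (pi / k) | \<infinity> \<Rightarrow> 2)"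

lemma coxeter_matrix_finite_ge_2:
  assumes "coxeter_matrix S M" "s \<in> S" "t \<in> S" "s \<noteq> t" "M s t = enat m"
  shows "m \<ge> 2"
proof -
  have "2 \<le> M s t" using assms unfolding coxeter_matrix_def by blast
  then show ?thesis using assms(5) by (simp add: numeral_eq_enat)
qed

lemma coxeter_matrix_sym:
  "coxeter_matrix S M \<Longrightarrow> s \<in> S \<Longrightarrow> t \<in> S \<Longrightarrow> M s t = M t s"
  unfolding coxeter_matrix_def by metis

lemma artin_form_exists:
  assumes "finite S" "coxeter_matrix S M" "a \<in> S" "c \<in> S" "a \<noteq> c"
  shows "\<exists>b. artin_form S M b \<and> b a c = cox_weight (M a c) \<and>
    (\<forall>s\<in>S. \<forall>t\<in>S. \<forall>m. s \<noteq> t \<longrightarrow> M s t = enat m \<longrightarrow> odd m \<longrightarrow> b s t \<noteq> 0)"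
proof -
  obtain j :: "'a \<Rightarrow> nat" where j: "inj_on j S"
    using finite_imp_inj_to_nat_seg[OF assms(1)] by blast
  \<comment> \<open>The sign of the form follows a numbering of the generators, negated if necessary
    so that a precedes c and \<open>b a c\<close> gets the positive sign.\<close>
  define i where "i s = (if j a < j c then int (j s) else - int (j s))" for s
  have i_inj: "s = t" if "i s = i t" "s \<in> S" "t \<in> S" for s t
    using that j by (auto simp: i_def inj_on_def split: if_splits)
  have "j a \<noteq> j c" using inj_onD[OF j] assms(3-5) by blast
  then have i_ac: "i a < i c" by (simp add: i_def)
  define b where "b s t = (if s = t then 0 else if i s < i t then cox_weight (M s t) else - cox_weight (M s t))"
    for s t
  have weight: "m = 2 \<and> cox_weight (M s t) = 0 \<or> m \<ge> 3 \<and> cox_weight (M s t) > 0 \<and>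
      chebyshev (cox_weight (M s t)) m = 0 \<and> chebyshev (- cox_weight (M s t)) m = 0"
    if st: "s \<in> S" "t \<in> S" "s \<noteq> t" "M s t = enat m" for s t m
  proof -
    have m: "m \<ge> 2" using coxeter_matrix_finite_ge_2[OF assms(2) st] .
    have w: "cox_weight (M s t) = 2 * cos (pi / m)" using st(4) by (simp add: cox_weight_def)
    have "chebyshev (cox_weight (M s t)) m = 0" unfolding w by (rule chebyshev_order[OF m])
    moreover from this have "chebyshev (- cox_weight (M s t)) m = 0"
      using chebyshev_uminus[of "cox_weight (M s t)" m] by simp
    moreover have "cox_weight (M s t) > 0" if "m \<ge> 3" unfolding w using mu_bounds(1)[OF that] by simp
    moreover have "cox_weight (M s t) = 0" if "m = 2" unfolding w using that by simp
    ultimately show ?thesis using m by (cases "m = 2") auto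
  qed
  have "artin_form S M b"
  proof
    show "finite S" by fact
    show "b t s = - b s t" if "s \<in> S" "t \<in> S" for s t
      using i_inj[OF _ that] coxeter_matrix_sym[OF assms(2) that] by (auto simp: b_def not_less)
    show "m = 2 \<and> b s t = 0 \<or> b s t \<noteq> 0 \<and> chebyshev (b s t) m = 0"
      if "s \<in> S" "t \<in> S" "s \<noteq> t" "M s t = enat m" for s t m
      using weight[OF that] that(3) by (auto simp: b_def)
  qed
  moreover have "b a c = cox_weight (M a c)" using i_ac assms(5) by (simp add: b_def)
  moreover have "b s t \<noteq> 0" if "s \<in> S" "t \<in> S" "s \<noteq> t" "M s t = enat m" "odd m" for s t m
    using weight[OF that(1-4)] that(3,5) by (auto simp: b_def)
  ultimately show ?thesis by blast
qed

context artin_form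
begin

context
  fixes X f
  assumes X: "X \<subseteq> S" and f: "word_retraction S M X f"
begin

lemma retract_words: "u \<in> words S \<Longrightarrow> f u \<in> words X"
  using f unfolding word_retraction_def by blast

text \<open>Under \<open>act\<close> the equivalences of \<open>word_retraction\<close> become
  equalities, so u to \<open>act (f u)\<close> is a genuine action, here by words in X.\<close>

lemma act_retract_append:
  "u \<in> words S \<Longrightarrow> v \<in> words S \<Longrightarrow> act (f (u @ v)) = act (f u) \<circ> act (f v)"
  using f unfolding word_retraction_def by (metis act_artin_eq act_append)

lemma act_retract_artin_eq: "artin_eq S M u v \<Longrightarrow> act (f u) = act (f v)"
  using f unfolding word_retraction_def by (metis act_artin_eq)

lemma act_retract_id: "u \<in> words X \<Longrightarrow> act (f u) = act u"
  using f unfolding word_retraction_def by (metis act_artin_eq)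

lemma act_retract_alt:
  assumes "s \<in> S" "t \<in> S"
  shows "act (f (alt s t k)) = alternate (act (f [(s, True)])) (act (f [(t, True)])) k"
  using assms
proof (induction k arbitrary: s t)
  case 0
  then show ?case by (simp add: act_retract_id)
next
  case (Suc k)
  have "act (f (alt s t (Suc k))) = act (f [(s, True)]) \<circ> act (f (alt t s k))"
    using act_retract_append[of "[(s, True)]" "alt t s k"] Suc.prems by (simp add: words_alt)
  then show ?case using Suc by simp
qed

lemma act_retract_braid:
  assumes "s \<in> S" "t \<in> S" "s \<noteq> t" "M s t = enat k"
  shows "alternate (act (f [(s, True)])) (act (f [(t, True)])) k =
    alternate (act (f [(t, True)])) (act (f [(s, True)])) k"
proof -
  have "artin_eq S M (alt s t k) (alt t s k)"
    using artin_eq.braid[of "[]" S "[]" s t M k] assms by simp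
  then show ?thesis using act_retract_artin_eq act_retract_alt assms(1,2) by metis
qed

text \<open>For odd k the braid relation says that t is conjugate to s by \<open>\<Pi>(s, t, k)\<close>.\<close>

lemma act_retract_conjugate:
  assumes "s \<in> S" "t \<in> S" "s \<noteq> t" "M s t = enat k" "odd k"
  shows "act (f [(t, True)]) \<circ> act (f (alt s t k)) = act (f (alt s t k)) \<circ> act (f [(s, True)])"
proof -
  have "artin_eq S M (alt s t k) (alt t s k)"
    using artin_eq.braid[of "[]" S "[]" s t M k] assms by simp
  then have eq: "act (f (alt s t k)) = act (f (alt t s k))" by (rule act_retract_artin_eq)
  have "[(t, True)] @ alt s t k = alt t s k @ [(s, True)]"
    using alt_Suc_right[of t s k] assms(5) by simp
  then have "act (f [(t, True)]) \<circ> act (f (alt s t k)) = act (f (alt t s k)) \<circ> act (f [(s, True)])"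
    using act_retract_append[of "[(t, True)]" "alt s t k"] act_retract_append[of "alt t s k" "[(s, True)]"]
      assms(1,2) by (simp add: words_alt)
  then show ?thesis using eq by simp
qed

end

text \<open>On the plane, the image of b' is the transvection along w = h (1, 0). The symplectic
  products of w with the vectors of a and c are, up to sign, its second and first coordinates, so
  the braid relations of b' with a and c constrain these.\<close>

lemma retraction_plane_vector:
  assumes abc: "a \<in> S" "b' \<in> S" "c \<in> S" "a \<noteq> b'" "a \<noteq> c" "b' \<noteq> c"
    and f: "word_retraction S M {a, c} f"
    and k: "M a b' = enat k" "odd k"
    and \<mu>: "b a c = \<mu>"
  shows "\<exists>h. let w = plane_act a \<mu> h (1, 0) in
    (\<mu> * snd w = 0 \<or> chebyshev (\<mu> * snd w) k = 0) \<and>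
    (\<forall>r. M b' c = enat r \<longrightarrow> \<mu> * fst w = 0 \<or> chebyshev (\<mu> * fst w) r = 0)"
proof -
  have X: "{a, c} \<subseteq> S" using abc by simp
  define h where "h = f (alt a b' k)"
  define x where "x = f [(b', True)]"
  define w where "w = plane_act a \<mu> h (1, 0)"
  have wd: "h \<in> words {a, c}" "x \<in> words {a, c}"
    using retract_words[OF X f] abc by (simp_all add: h_def x_def words_alt)
  have pl: "act u (plane a c v) = plane a c (plane_act a \<mu> u v)" if "u \<in> words {a, c}" for u v
    using act_plane[OF that abc(1,3,5)] \<mu> by simp
  have fa: "act (f [(a, True)]) = act [(a, True)]" and fc: "act (f [(c, True)]) = act [(c, True)]"
    by (intro act_retract_id[OF X f]; simp)+
  have pa: "act (f [(a, True)]) (plane a c v) = plane a c (shear1 \<mu> v)" for v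
    using pl[of "[(a, True)]" v] unfolding fa by simp
  have pc: "act (f [(c, True)]) (plane a c v) = plane a c (shear2 \<mu> v)" for v
    using pl[of "[(c, True)]" v] abc(5) unfolding fc by simp
  have "plane a c (plane_act a \<mu> x (plane_act a \<mu> h v)) = plane a c (plane_act a \<mu> h (shear1 \<mu> v))" for v
    using fun_cong[OF act_retract_conjugate[OF X f abc(1,2,4) k], of "plane a c v"]
    by (simp only: o_apply pa h_def[symmetric] x_def[symmetric] pl[OF wd(1)] pl[OF wd(2)])
  then have "plane_act a \<mu> x (plane_act a \<mu> h v) = plane_act a \<mu> h (shear1 \<mu> v)" for v
    using plane_inj[OF abc(5)] by blast
  then have "plane_act a \<mu> x = transvection \<mu> w"
    unfolding w_def by (rule conjugate_shear_eq_transvection)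
  then have px: "act (f [(b', True)]) (plane a c v) = plane a c (transvection \<mu> w v)" for v
    unfolding x_def[symmetric] pl[OF wd(2)] by simp
  \<comment> \<open>A braid relation between maps that preserve the plane restricts to it, because
    \<open>plane a c\<close> is injective.\<close>
  have rel: "alternate g1 g2 n = alternate g2 g1 n"
    if "\<And>v. F1 (plane a c v) = plane a c (g1 v)" "\<And>v. F2 (plane a c v) = plane a c (g2 v)"
      "alternate F1 F2 n = alternate F2 F1 n" for F1 F2 g1 g2 n
  proof
    fix v
    have "plane a c (alternate g1 g2 n v) = plane a c (alternate g2 g1 n v)"
      using alternate_intertwine[of F1 "plane a c" g1 F2 g2, OF that(1,2)]
        alternate_intertwine[of F2 "plane a c" g2 F1 g1, OF that(2,1)] that(3) by metis
    then show "alternate g1 g2 n v = alternate g2 g1 n v" by (rule plane_inj[OF abc(5)])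
  qed
  have "\<mu> * det2 (1, 0) w = 0 \<or> chebyshev (\<mu> * det2 (1, 0) w) k = 0"
    using rel[OF pa px act_retract_braid[OF X f abc(1,2,4) k(1)]]
    by (intro alternate_transvections_eqD) (simp only: shear1_eq_transvection)
  then have "\<mu> * snd w = 0 \<or> chebyshev (\<mu> * snd w) k = 0" by (cases w) simp
  moreover have "\<mu> * fst w = 0 \<or> chebyshev (\<mu> * fst w) r = 0" if "M b' c = enat r" for r
  proof -
    have "\<mu> * det2 w (0, 1) = 0 \<or> chebyshev (\<mu> * det2 w (0, 1)) r = 0"
      using rel[OF px pc act_retract_braid[OF X f abc(2,3,6) that]]
      by (intro alternate_transvections_eqD) (simp only: shear2_eq_transvection)
    then show ?thesis by (cases w) simp
  qed
  ultimately show ?thesis unfolding w_def by (auto simp: Let_def)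
qed

text \<open>When \<open>b a c = 0\<close> all words in a and c act by commuting maps, so the
  conjugation relating b' to s is trivial, on the whole space and not only on the plane.\<close>

lemma retraction_commuting_odd:
  assumes abc: "a \<in> S" "b' \<in> S" "c \<in> S" "s \<in> {a, c}" "s \<noteq> b'"
    and f: "word_retraction S M {a, c} f"
    and k: "M s b' = enat k" "odd k"
    and ac: "b a c = 0"
  shows "act (f [(b', True)]) = act [(s, True)]"
proof
  fix v
  have X: "{a, c} \<subseteq> S" "s \<in> S" using abc by auto
  define h where "h = f (alt s b' k)"
  have h: "h \<in> words {a, c}"
    using retract_words[OF X(1) f] abc X by (simp add: h_def words_alt)
  then have "h \<in> words S" using words_mono[OF X(1)] by blast
  then obtain u where u: "v = act h u" using surj_act by (metis surjD)
  have "act (f [(s, True)]) = act [(s, True)]"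
    using abc(4) by (intro act_retract_id[OF X(1) f]) auto
  then have "act (f [(b', True)]) v = act h (act [(s, True)] u)"
    using fun_cong[OF act_retract_conjugate[OF X(1) f X(2) abc(2,5) k], of u] u by (simp add: h_def)
  also have "\<dots> = act [(s, True)] v"
    using act_commute_transv[OF h abc(1,3) ac abc(4), of 1] u by simp
  finally show "act (f [(b', True)]) v = act [(s, True)] v" .
qed

end

subsection \<open>The necessary condition\<close>

text \<open>A Chebyshev zero lies strictly between -2 and 2, so the gap leaves only t = 1 or t = -1.
  Then \<mu> itself is a zero, which forces p to divide n.\<close>

lemma gap_chebyshev_zero_imp_dvd:
  fixes t :: real and p n :: nat
  assumes "p \<ge> 3" "n > 0" and \<mu>: "\<mu> = 2 * cos (pi / p)"
    and gap: "t = 0 \<or> \<bar>t\<bar> = 1 \<or> \<mu> * \<bar>t\<bar> \<ge> 2"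
    and zero: "\<mu> * t = 0 \<or> chebyshev (\<mu> * t) n = 0"
    and "t \<noteq> 0"
  shows "p dvd n"
proof -
  have pos: "\<mu> > 0" using mu_bounds(1)[OF assms(1)] by (simp add: \<mu>)
  then have z: "chebyshev (\<mu> * t) n = 0" using zero assms(6) by simp
  have "\<mu> * \<bar>t\<bar> < 2"
    using chebyshev_zero_imp_abs_less_2[OF z assms(2)] pos by (simp add: abs_mult)
  then have "t = 1 \<or> t = - 1" using gap assms(6) by linarith
  then have "chebyshev \<mu> n = 0" using z chebyshev_uminus[of \<mu> n] by auto
  then show ?thesis using chebyshev_zero_imp_dvd[of p n] assms(1) by (simp add: \<mu>)
qed

text \<open>The entry under study is \<open>M a c\<close>, constrained by a retraction onto the
  subgroup generated by a and c.\<close>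

locale retractable_triple =
  fixes S :: "'a set" and M :: "'a \<Rightarrow> 'a \<Rightarrow> enat" and a b c :: 'a and k r :: nat
  assumes finite: "finite S" and cox: "coxeter_matrix S M" and retractable: "parabolic_retractable S M"
    and abc: "a \<in> S" "b \<in> S" "c \<in> S" "a \<noteq> b" "a \<noteq> c" "b \<noteq> c"
    and k: "M a b = enat k" "odd k" and r: "M b c = enat r"
begin

lemma word_retraction_exists: "\<exists>f. word_retraction S M {a, c} f"
proof -
  have X: "{a, c} \<subseteq> S" using abc by simp
  then show ?thesis
    using retractable has_retraction_iff_word_retraction[OF X]
    unfolding parabolic_retractable_def by blast
qed

lemma kr_pos: "k > 0" "r > 0"
  using coxeter_matrix_finite_ge_2[OF cox abc(1,2,4) k(1)]
    coxeter_matrix_finite_ge_2[OF cox abc(2,3,6) r] by auto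

lemma plane_vector:
  "\<exists>h. let \<mu> = cox_weight (M a c); w = plane_act a \<mu> h (1, 0) in
    (\<mu> * snd w = 0 \<or> chebyshev (\<mu> * snd w) k = 0) \<and>
    (\<mu> * fst w = 0 \<or> chebyshev (\<mu> * fst w) r = 0)"
proof -
  obtain f where f: "word_retraction S M {a, c} f" using word_retraction_exists by blast
  obtain \<beta> where \<beta>: "artin_form S M \<beta>" "\<beta> a c = cox_weight (M a c)"
    using artin_form_exists[OF finite cox abc(1,3,5)] by blast
  show ?thesis
    using artin_form.retraction_plane_vector[OF \<beta>(1) abc f k \<beta>(2)] r by (auto simp: Let_def)
qed

text \<open>An infinite entry has weight 2. The first coordinate of the plane vector is then an odd
  integer i, and 2 i is too large in absolute value to be a Chebyshev zero.\<close>

lemma entry_finite: "M a c \<noteq> \<infinity>"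
proof
  assume "M a c = \<infinity>"
  then have "cox_weight (M a c) = 2" by (simp add: cox_weight_def)
  then obtain h where h: "2 * fst (plane_act a 2 h (1, 0)) = 0 \<or>
      chebyshev (2 * fst (plane_act a 2 h (1, 0))) r = 0"
    using plane_vector by (auto simp: Let_def)
  obtain i j :: int where ij: "plane_act a 2 h (1, 0) = (real_of_int i, real_of_int j)" "odd i"
    using plane_act_2_parity[of a h] by blast
  then have "i \<noteq> 0" by auto
  then have "1 \<le> \<bar>i\<bar>" by linarith
  then have "real_of_int 1 \<le> real_of_int \<bar>i\<bar>" by (simp only: of_int_le_iff)
  then have "\<bar>2 * real_of_int i\<bar> \<ge> 2" by simp
  moreover have "chebyshev (2 * real_of_int i) r = 0" using h ij \<open>i \<noteq> 0\<close> by simp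
  ultimately show False using chebyshev_zero_imp_abs_less_2 kr_pos(2) by fastforce
qed

text \<open>A nonzero first coordinate of w makes p divide r, a nonzero second one makes p divide k.
  They do not both vanish, and for even p the first is nonzero.\<close>

lemma entry_dvd:
  assumes p: "M a c = enat p" "p \<ge> 3"
  shows "even p \<Longrightarrow> p dvd r" "p dvd k \<or> p dvd r"
proof -
  define \<mu> where "\<mu> = 2 * cos (pi / p)"
  have "cox_weight (M a c) = \<mu>" using p(1) by (simp add: cox_weight_def \<mu>_def)
  then obtain h where h: "\<mu> * snd (plane_act a \<mu> h (1, 0)) = 0 \<or> chebyshev (\<mu> * snd (plane_act a \<mu> h (1, 0))) k = 0"
    "\<mu> * fst (plane_act a \<mu> h (1, 0)) = 0 \<or> chebyshev (\<mu> * fst (plane_act a \<mu> h (1, 0))) r = 0"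
    using plane_vector unfolding Let_def by metis
  define w where "w = plane_act a \<mu> h (1, 0)"
  have gap: "fst w = 0 \<or> \<bar>fst w\<bar> = 1 \<or> \<mu> * \<bar>fst w\<bar> \<ge> 2"
    "snd w = 0 \<or> \<bar>snd w\<bar> = 1 \<or> \<mu> * \<bar>snd w\<bar> \<ge> 2"
    "snd w = 0 \<Longrightarrow> \<bar>fst w\<bar> = 1" "even p \<Longrightarrow> fst w \<noteq> 0"
    using hecke_orbit_gap[OF p(2) plane_act_hecke_orbit[OF p(2), of a h]]
    unfolding \<mu>_def[symmetric] w_def[symmetric] by auto
  have dvd_r: "p dvd r" if "fst w \<noteq> 0"
    using gap_chebyshev_zero_imp_dvd[OF p(2) kr_pos(2) \<mu>_def gap(1) h(2)[folded w_def] that] .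
  have dvd_k: "p dvd k" if "snd w \<noteq> 0"
    using gap_chebyshev_zero_imp_dvd[OF p(2) kr_pos(1) \<mu>_def gap(2) h(1)[folded w_def] that] .
  show "even p \<Longrightarrow> p dvd r" using dvd_r gap(4) by blast
  show "p dvd k \<or> p dvd r" using dvd_r dvd_k gap(3) by fastforce
qed

text \<open>When a and c commute, the representation is trivial on the plane, but then the image of b
  would have to be equal to both a and c.\<close>

lemma entry_2_imp_even:
  assumes "M a c = enat 2"
  shows "even r"
proof (rule ccontr)
  assume "odd r"
  obtain f where f: "word_retraction S M {a, c} f" using word_retraction_exists by blast
  obtain \<beta> where \<beta>: "artin_form S M \<beta>" "\<beta> a c = cox_weight (M a c)"
    "\<forall>s\<in>S. \<forall>t\<in>S. \<forall>m. s \<noteq> t \<longrightarrow> M s t = enat m \<longrightarrow> odd m \<longrightarrow> \<beta> s t \<noteq> 0"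
    using artin_form_exists[OF finite cox abc(1,3,5)] by blast
  interpret artin_form S M \<beta> by (rule \<beta>(1))
  have ac: "\<beta> a c = 0" using \<beta>(2) assms by (simp add: cox_weight_def)
  have r': "M c b = enat r" using r coxeter_matrix_sym[OF cox abc(2,3)] by simp
  have "act [(a, True)] = act [(c, True)]"
    using retraction_commuting_odd[OF abc(1-3) _ _ f k ac] retraction_commuting_odd[OF abc(1-3) _ _ f r' \<open>odd r\<close> ac]
      abc by auto
  \<comment> \<open>The two transvections are told apart on the basis vector of b by the coordinate
    at a: it becomes \<beta> a b, nonzero as k is odd, under the first and stays 0 under the
    second.\<close>
  moreover have "act [(a, True)] (plane a b (0, 1)) a = \<beta> a b"
    using pairing_plane[OF abc(1,2,4), of a 0 1] by (simp add: transv_def)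
  moreover have "act [(c, True)] (plane a b (0, 1)) a = 0"
    using abc(5) by (simp add: transv_def)
  ultimately show False using \<beta>(3) abc(1,2,4) k by auto
qed

end

text \<open>The blocks are the classes of the relation of having an odd entry. The constraints on
  triples make it transitive, give compatibility inside a class, and force constant entries between
  classes.\<close>

lemma parabolic_retract_compatible_if_retractable:
  assumes "finite S" "coxeter_matrix S M" "parabolic_retractable S M"
  shows "parabolic_retract_compatible S M"
proof -
  define oddpair where "oddpair s t \<longleftrightarrow> (\<exists>m. M s t = enat m \<and> odd m)" for s t
  note sym = coxeter_matrix_sym[OF assms(2)]
  have triple: "retractable_triple S M a b c k r"
    if "a \<in> S" "b \<in> S" "c \<in> S" "a \<noteq> b" "a \<noteq> c" "b \<noteq> c" "M a b = enat k" "odd k" "M b c = enat r"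
    for a b c k r
    using that assms by unfold_locales
  have self: "oddpair s s" if "s \<in> S" for s
    using assms(2) that unfolding coxeter_matrix_def oddpair_def by (auto simp: one_enat_def)
  have oddpair_sym: "oddpair t s" if "oddpair s t" "s \<in> S" "t \<in> S" for s t
    using that sym[of s t] by (simp add: oddpair_def)
  have even_dvd: "p dvd r"
    if H: "a \<in> S" "b \<in> S" "c \<in> S" "a \<noteq> b" "a \<noteq> c" "b \<noteq> c" "oddpair a b"
      "M b c = enat r" "M a c = enat p" "even p" for a b c r p
  proof -
    obtain k where k: "M a b = enat k" "odd k" using H(7) unfolding oddpair_def by blast
    interpret retractable_triple S M a b c k r using triple H k by blast
    have "p \<ge> 2" using coxeter_matrix_finite_ge_2[OF assms(2) H(1,3,5,9)] .
    then consider "p = 2" | "p \<ge> 3" by linarith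
    then show ?thesis
    proof cases
      case 1
      then show ?thesis using entry_2_imp_even H(9) by simp
    next
      case 2
      then show ?thesis using entry_dvd(1) H(9,10) by simp
    qed
  qed
  have fin: "M a c \<noteq> \<infinity>"
    if "a \<in> S" "b \<in> S" "c \<in> S" "a \<noteq> b" "a \<noteq> c" "b \<noteq> c" "oddpair a b" "M b c = enat r" for a b c r
    using retractable_triple.entry_finite[OF triple[OF that(1-6) _ _ that(8)]] that(7)
    unfolding oddpair_def by blast
  have oddpair_trans: "oddpair a c"
    if H: "oddpair a b" "oddpair b c" "a \<in> S" "b \<in> S" "c \<in> S" for a b c
  proof (cases "a = b \<or> b = c \<or> a = c")
    case True
    then show ?thesis using H self by auto
  next
    case False
    obtain r where r: "M b c = enat r" "odd r" using H(2) unfolding oddpair_def by blast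
    obtain p where p: "M a c = enat p" using fin[OF H(3-5) _ _ _ H(1) r(1)] False by auto
    have "odd p"
    proof
      assume "even p"
      then have "p dvd r" using even_dvd[OF H(3-5) _ _ _ H(1) r(1) p] False by blast
      then show False using \<open>even p\<close> r(2) dvd_trans by blast
    qed
    then show ?thesis using p unfolding oddpair_def by blast
  qed
  have odd_dvd: "p dvd k \<or> p dvd r"
    if "a \<in> S" "b \<in> S" "c \<in> S" "a \<noteq> b" "a \<noteq> c" "b \<noteq> c" "M a b = enat k" "odd k"
      "M b c = enat r" "M a c = enat p" "odd p" for a b c k r p
  proof -
    have "p \<ge> 2" using coxeter_matrix_finite_ge_2[OF assms(2) that(1,3,5,10)] .
    then have "p \<ge> 3" using that(11) by (cases "p = 2") auto
    then show ?thesis using retractable_triple.entry_dvd(2)[OF triple[OF that(1-9)] that(10)] by blast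
  qed
  define R where "R = {(s, t). s \<in> S \<and> t \<in> S \<and> oddpair s t}"
  have R: "equiv S R"
    unfolding R_def
    by (intro equivI) (auto simp: refl_on_def sym_def trans_def self intro: oddpair_sym oddpair_trans)
  have same_class: "T \<subseteq> S" "s \<in> T \<Longrightarrow> t \<in> T \<Longrightarrow> oddpair s t" if "T \<in> S // R" for T s t
    using that in_quotient_imp_subset[OF R that] quotient_eq_iff[OF R that that, of s t]
    by (auto simp: R_def)
  have other_class: "\<not> oddpair s t"
    if "T \<in> S // R" "T' \<in> S // R" "T \<noteq> T'" "s \<in> T" "t \<in> T'" for T T' s t
    using quotient_eqI[OF R that(1,2,4,5)] that same_class(1) by (auto simp: R_def)
  have "retract_compatible T M" if T: "T \<in> S // R" for T
    unfolding retract_compatible_def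
  proof (intro disjI2 conjI ballI impI)
    show "odd_matrix T M"
      unfolding odd_matrix_def using same_class(2)[OF T] unfolding oddpair_def by blast
    fix a b c assume in_T: "a \<in> T" "b \<in> T" "c \<in> T" and ne: "a \<noteq> b \<and> a \<noteq> c \<and> b \<noteq> c"
    then have in_S: "a \<in> S" "b \<in> S" "c \<in> S" using same_class(1)[OF T] by auto
    obtain p where p: "M a b = enat p" "odd p" using same_class(2)[OF T in_T(1,2)] unfolding oddpair_def by blast
    obtain q where q: "M a c = enat q" "odd q" using same_class(2)[OF T in_T(1,3)] unfolding oddpair_def by blast
    obtain r where r: "M b c = enat r" "odd r" using same_class(2)[OF T in_T(2,3)] unfolding oddpair_def by blast
    have sy: "M b a = enat p" "M c a = enat q" "M c b = enat r"
      using sym in_S p q r by metis+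
    have pos: "p > 0" "q > 0" "r > 0" using p q r by (auto intro: odd_pos)
    have d: "q dvd p \<or> q dvd r" "p dvd q \<or> p dvd r" "r dvd p \<or> r dvd q"
      using odd_dvd[of a b c p r q] odd_dvd[of a c b q r p] odd_dvd[of b a c p q r] in_S ne p q r sy
      by auto
    \<comment> \<open>Each entry divides one of the other two, so a largest entry equals another
      one, and the third divides this common value.\<close>
    have "(p = q \<and> r dvd p) \<or> (p = r \<and> q dvd p) \<or> (q = r \<and> p dvd q)"
      using d pos by (metis dvd_antisym dvd_trans)
    then consider "p = q" "r dvd p" | "p = r" "q dvd p" | "q = r" "p dvd q" by blast
    then show "\<exists>x y z. {x, y, z} = {a, b, c} \<and> M x y = M x z \<and>
        (\<exists>p q. M x y = enat p \<and> M y z = enat q \<and> q dvd p)"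
    proof cases
      case 1
      have "{a, b, c} = {a, b, c} \<and> M a b = M a c \<and> (\<exists>p q. M a b = enat p \<and> M b c = enat q \<and> q dvd p)"
        using 1 p q r by (intro conjI exI[of _ p] exI[of _ r]) simp_all
      then show ?thesis by (intro exI)
    next
      case 2
      have "{b, a, c} = {a, b, c} \<and> M b a = M b c \<and> (\<exists>p q. M b a = enat p \<and> M a c = enat q \<and> q dvd p)"
        using 2 p q r sy by (intro conjI exI[of _ p] exI[of _ q]) auto
      then show ?thesis by (intro exI)
    next
      case 3
      have "{c, a, b} = {a, b, c} \<and> M c a = M c b \<and> (\<exists>p q. M c a = enat p \<and> M a b = enat q \<and> q dvd p)"
        using 3 p q r sy by (intro conjI exI[of _ q] exI[of _ p]) auto
      then show ?thesis by (intro exI)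
    qed
  qed
  moreover have "\<exists>n. (n = \<infinity> \<or> (\<exists>k. n = enat k \<and> even k)) \<and> (\<forall>a\<in>T. \<forall>b\<in>T'. M a b = n)"
    if T: "T \<in> S // R" "T' \<in> S // R" "T \<noteq> T'" for T T'
  proof -
    \<comment> \<open>Moving one generator within its class replaces a finite entry by a divisor.
      Moving back gives the converse divisibility, hence the constancy in
      \<open>const\<close>.\<close>
    have le: "\<exists>p. M a c = enat p \<and> p dvd r"
      if U: "U \<in> S // R" "U' \<in> S // R" "U \<noteq> U'" and ab: "a \<in> U" "b \<in> U" "c \<in> U'" "M b c = enat r"
      for U U' a b c r
    proof (cases "a = b")
      case True
      then show ?thesis using ab(4) by simp
    next
      case False
      have no: "\<not> oddpair a c" "\<not> oddpair b c" using other_class[OF U] ab by auto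
      have in_S: "a \<in> S" "b \<in> S" "c \<in> S" using same_class(1) U ab by auto
      have ne: "a \<noteq> c" "b \<noteq> c" using no self in_S by auto
      have ab': "oddpair a b" using same_class(2)[OF U(1) ab(1,2)] .
      obtain p where p: "M a c = enat p" using fin[OF in_S False ne ab' ab(4)] by auto
      then have "even p" using no(1) by (auto simp: oddpair_def)
      then show ?thesis using even_dvd[OF in_S False ne ab' ab(4) p] p by blast
    qed
    have const: "M a c = M b c"
      if U: "U \<in> S // R" "U' \<in> S // R" "U \<noteq> U'" and ab: "a \<in> U" "b \<in> U" "c \<in> U'" for U U' a b c
    proof (cases "M b c")
      case (enat r)
      obtain p where p: "M a c = enat p" "p dvd r" using le[OF U ab enat] by blast
      obtain r' where "M b c = enat r'" "r' dvd p" using le[OF U ab(2,1,3) p(1)] by blast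
      then show ?thesis using enat p dvd_antisym by auto
    next
      case infinity
      show ?thesis
      proof (cases "M a c")
        case (enat p)
        then show ?thesis using le[OF U ab(2,1,3) enat] infinity by auto
      qed (simp add: infinity)
    qed
    have sub: "T \<subseteq> S" "T' \<subseteq> S" using same_class(1) T by auto
    obtain s t where st: "s \<in> T" "t \<in> T'"
      using in_quotient_imp_non_empty[OF R] T by blast
    have "M a b = M s t" if "a \<in> T" "b \<in> T'" for a b
    proof -
      have "M a b = M s b" using const[OF T that(1) st(1) that(2)] .
      \<comment> \<open>Constancy in the second argument comes from symmetry, with the roles of the
        two classes exchanged.\<close>
      also have "\<dots> = M b s" using sym sub that st by blast
      also have "\<dots> = M t s" using const[OF T(2,1) T(3)[symmetric] that(2) st(2,1)] .
      also have "\<dots> = M s t" using sym sub st by blast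
      finally show ?thesis .
    qed
    moreover have "M s t = \<infinity> \<or> (\<exists>k. M s t = enat k \<and> even k)"
      using other_class[OF T st] unfolding oddpair_def by (cases "M s t") auto
    ultimately show ?thesis by blast
  qed
  ultimately show ?thesis
    unfolding parabolic_retract_compatible_def using partition_on_quotient[OF R] by blast
qed

theorem theorem1p2:
  fixes S :: "'a set" and M :: "'a \<Rightarrow> 'a \<Rightarrow> enat"
  assumes "finite S" and "coxeter_matrix S M"
  shows "parabolic_retractable S M \<longleftrightarrow> parabolic_retract_compatible S M"
  using parabolic_retractable_if_compatible[OF assms]
    parabolic_retract_compatible_if_retractable[OF assms] by blast

end
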